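(* For every positive integer $k$ there exists an integer $N$ such that every simple permutation of length at least $N$ contains an alternation of length $k$ or an oscillation of length $k$.
   Context: Permutations of length $n$ are written as sequences $\pi(1)\cdots\pi(n)$ of the elements of $[n]$. A permutation (or infinite sequence of distinct numbers) contains a permutation $\sigma$ if it has a subsequence order isomorphic to $\sigma$ (same relative comparisons). An interval of a permutation $\pi$ of length $n$ is a set of contiguous indices $I=[a,b]$ such that $\{\pi(i): i\in I\}$ is also a set of consecutive integers. $\pi$ is simple if its only intervals have sizes $0$, $1$ and $n$. The symmetries of permutations are the eight maps generated by reversal $\pi\mapsto \pi(n)\cdots\pi(1)$ and inversion $\pi\mapsto\pi^{-1}$ (the dihedral group of order eight acting on plots $\{(i,\pi(i))\}$). An alternation is a permutation in which every odd entry lies to the left of every even entry, or any image of such a permutation under one of the eight symmetries. The increasing oscillating sequence is the infinite sequence $4,1,6,3,8,5,\dots,2k+2,2k-1,\dots$. An increasing oscillation is any simple permutation contained in the increasing oscillating sequence; a decreasing oscillation is the reverse of an increasing oscillation; an oscillation is a permutation that is either an increasing oscillation or a decreasing oscillation. *)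

theory Defs
  imports Main "HOL-Library.Sublist"
begin

text \<open>A permutation of length \<open>n\<close> is the list of its values, a rearrangement of \<open>1, ..., n\<close>;
  values start at 1, whereas list positions start at 0.\<close>

definition is_perm :: "nat list \<Rightarrow> bool" where
  "is_perm p \<longleftrightarrow> distinct p \<and> set p = {1..length p}"

definition order_isomorphic :: "nat list \<Rightarrow> nat list \<Rightarrow> bool" where
  "order_isomorphic xs ys \<longleftrightarrow> length xs = length ys \<and>
     (\<forall>i<length xs. \<forall>j<length xs. xs ! i < xs ! j \<longleftrightarrow> ys ! i < ys ! j)"

definition contains :: "nat list \<Rightarrow> nat list \<Rightarrow> bool" where
  "contains p q \<longleftrightarrow> (\<exists>xs. subseq xs p \<and> order_isomorphic xs q)"

text \<open>The list \<open>js\<close> holds the positions of a finite subsequence of the infinite sequence \<open>s\<close>.\<close>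

definition seq_contains :: "(nat \<Rightarrow> nat) \<Rightarrow> nat list \<Rightarrow> bool" where
  "seq_contains s q \<longleftrightarrow> (\<exists>js. sorted_wrt (<) js \<and> order_isomorphic (map s js) q)"

text \<open>Half-open ranges, so that the empty interval is included.\<close>

definition is_interval_of :: "nat list \<Rightarrow> nat set \<Rightarrow> bool" where
  "is_interval_of p I \<longleftrightarrow> (\<exists>a b. I = {a..<b} \<and> b \<le> length p) \<and>
     (\<exists>c d. (\<lambda>i. p ! i) ` I = {c..<d})"

definition simple_perm :: "nat list \<Rightarrow> bool" where
  "simple_perm p \<longleftrightarrow> is_perm p \<and>
     (\<forall>I. is_interval_of p I \<longrightarrow> card I \<in> {0, 1, length p})"

text \<open>The entry of the inverse at value \<open>v\<close> is the 1-based position of \<open>v\<close>.\<close>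

definition perm_inverse :: "nat list \<Rightarrow> nat list" where
  "perm_inverse p =
     map (\<lambda>v. Suc (THE i. i < length p \<and> p ! i = v)) [1..<Suc (length p)]"

text \<open>Closure under composition alone gives the whole dihedral group, since reversal and
  inversion are involutions on permutations.\<close>

inductive_set symmetries :: "(nat list \<Rightarrow> nat list) set" where
  sym_id: "id \<in> symmetries"
| sym_rev: "f \<in> symmetries \<Longrightarrow> rev \<circ> f \<in> symmetries"
| sym_inverse: "f \<in> symmetries \<Longrightarrow> perm_inverse \<circ> f \<in> symmetries"

definition odds_left_of_evens :: "nat list \<Rightarrow> bool" where
  "odds_left_of_evens p \<longleftrightarrow>
     (\<forall>i<length p. \<forall>j<length p. odd (p ! i) \<and> even (p ! j) \<longrightarrow> i < j)"

definition alternation :: "nat list \<Rightarrow> bool" where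
  "alternation q \<longleftrightarrow> (\<exists>p f. is_perm p \<and> odds_left_of_evens p \<and> f \<in> symmetries \<and> q = f p)"

text \<open>The sequence 4, 1, 6, 3, 8, 5, ..., indexed from 0.\<close>

definition inc_osc_seq :: "nat \<Rightarrow> nat" where
  "inc_osc_seq i = (if even i then i + 4 else i)"

definition increasing_oscillation :: "nat list \<Rightarrow> bool" where
  "increasing_oscillation q \<longleftrightarrow> simple_perm q \<and> seq_contains inc_osc_seq q"

definition decreasing_oscillation :: "nat list \<Rightarrow> bool" where
  "decreasing_oscillation q \<longleftrightarrow> (\<exists>p. increasing_oscillation p \<and> q = rev p)"

definition oscillation :: "nat list \<Rightarrow> bool" where
  "oscillation q \<longleftrightarrow> increasing_oscillation q \<or> decreasing_oscillation q"

end

theory Submission imports Defs begin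

text \<open>
  Start with two entries at adjacent positions and enlarge their hull repeatedly: since the
  permutation is simple, some entry outside the hull slices it, and we add such a pin, the outermost
  one in its direction. Walking back from the last position gives a pin sequence in which every pin
  separates its predecessor from all earlier entries. If there is no long alternation, then every
  pin has boundedly many possible predecessors, because two predecessors in the same direction that
  are neighbours along the separating line contradict the maximal choice of the pins. Since the
  number of starting pairs is large, some pin sequence is long. Each change between left and
  right (or up and down) in it contributes to an alternation around the starting entry, so
  a long stretch without changes remains, and that stretch is an oscillation.
\<close>

section \<open>Finite sets and the shape of oscillations\<close>

text \<open>A pin sequence grown from one given pair may stop early, so no single starting pair is
  sure to give a long one. This is why many disjoint pairs are used, all sent to the same end, the
  entry in the last position. That entry can serve as a common end because it is extreme: no hull
  contains it unless it was added itself. Without an alternation of length \<open>k\<close>, an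
  entry has at most \<open>k\<close> predecessors in each of the four directions and slices at most
  \<open>k\<close> pairs along each axis, so at most \<open>2 * k * (\<Sum>i<l. (4 * k) ^ i)\<close>
  pairs reach it with at most \<open>l\<close> pins. Changes of side are also sorted by the four
  directions, so fewer than \<open>4 * k\<close> of them occur. The stretch asked for has
  \<open>2 * k\<close> pins rather than \<open>k\<close>, because normalizing the signs reverses the
  sequence and needs an even number of points. Lengths below 4 are treated apart: no permutation of
  length 3 is simple, hence there is no oscillation of that length.\<close>

lemma window_avoiding:
  fixes C :: "nat set"
  assumes "finite C" "card C < a"
  shows "\<exists>i<a. C \<inter> {d + i * w..<d + Suc i * w} = {}"
proof (rule ccontr)
  assume "\<not> ?thesis"
  then have "\<forall>i<a. \<exists>x. x \<in> C \<and> d + i * w \<le> x \<and> x < d + Suc i * w" by fastforce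
  then obtain h where h: "\<And>i. i < a \<Longrightarrow> h i \<in> C \<and> d + i * w \<le> h i \<and> h i < d + Suc i * w" by metis
  have "h i < h j" if "i < j" "j < a" for i j
  proof -
    have "Suc i * w \<le> j * w" using that by (intro mult_right_mono) auto
    then show ?thesis using h[of i] h[of j] that by linarith
  qed
  then have "inj_on h {..<a}" by (metis inj_onI lessThan_iff nat_neq_iff)
  moreover have "h ` {..<a} \<subseteq> C" using h by blast
  ultimately have "a \<le> card C" using assms(1) by (metis card_image card_lessThan card_mono)
  then show False using assms by simp
qed

lemma finite_has_maximizer:
  fixes h :: "'a \<Rightarrow> 'b::linorder"
  assumes "finite A" "A \<noteq> {}"
  obtains m where "m \<in> A" "\<And>x. x \<in> A \<Longrightarrow> h x \<le> h m"
proof -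
  have "Max (h ` A) \<in> h ` A" using assms by simp
  then obtain m where "m \<in> A" "Max (h ` A) = h m" by auto
  moreover have "h x \<le> Max (h ` A)" if "x \<in> A" for x using assms that by simp
  ultimately show thesis using that by metis
qed

text \<open>The points of the increasing oscillating sequence, ordered along the path formed by its
  inversions: point \<open>l\<close> has position \<open>osc_rank True l\<close> (counted from 0) and value
  \<open>osc_rank False l\<close>.\<close>

definition osc_rank :: "bool \<Rightarrow> nat \<Rightarrow> nat" where
  "osc_rank b l = (if even l then l + 1 else if b then l - 1 else l + 3)"

text \<open>Each axis follows the path order up to swaps of neighbours: 0 with 1, 2 with 3, and so
  on in position, 1 with 2, 3 with 4, and so on in value. Pins with constant signs produce the same
  comparisons.\<close>

lemma osc_rank_less:
  assumes "i < j"
  shows "(if Suc i = j \<and> b = odd j then osc_rank b j < osc_rank b i else osc_rank b i < osc_rank b j)"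
proof (cases "Suc i = j")
  case True
  then show ?thesis by (auto simp: osc_rank_def)
next
  case False
  then have "i + 2 \<le> j" using assms by simp
  \<comment> \<open>The offsets in \<open>osc_rank\<close> for the two parities differ by 2, so a
    gap of 3 preserves the order.\<close>
  moreover have "i + 3 \<le> j" if "odd i \<noteq> odd j"
    using that \<open>i + 2 \<le> j\<close> by presburger
  ultimately show ?thesis using False by (auto simp: osc_rank_def odd_pos)
qed

lemma osc_rank_involution: "osc_rank True (osc_rank True l) = l"
  by (auto simp: osc_rank_def)

lemma inc_osc_seq_rank: "inc_osc_seq (osc_rank True l) = osc_rank False l"
  by (auto simp: osc_rank_def inc_osc_seq_def elim!: oddE)

text \<open>A pair of consecutive indices in \<open>J\<close> absorbs its neighbours, and any two elements of \<open>J\<close>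
  yield such a pair.\<close>

lemma osc_rank_convex:
  assumes k: "4 \<le> k" and J: "J \<subseteq> {..<k}" "i \<in> J" "j \<in> J" "i < j"
    and conv: "\<And>b i j l. i \<in> J \<Longrightarrow> j \<in> J \<Longrightarrow> l < k \<Longrightarrow> osc_rank b i < osc_rank b l \<Longrightarrow>
      osc_rank b l < osc_rank b j \<Longrightarrow> l \<in> J"
  shows "J = {..<k}"
proof -
  have right: "i + 2 \<in> J" if "i \<in> J" "Suc i \<in> J" "i + 2 < k" for i
    by (rule conv[of i "Suc i" _ "odd i"]) (use that in \<open>auto simp: osc_rank_def\<close>)
  have left: "i - 1 \<in> J" if "i \<in> J" "Suc i \<in> J" "0 < i" for i
    by (rule conv[of i "Suc i" _ "odd i"]) (use that J(1) in \<open>auto simp: osc_rank_def\<close>)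
  have "\<exists>i. i \<in> J \<and> Suc i \<in> J"
  proof -
    have lt: "i < k" "j < k" using J by auto
    \<comment> \<open>Here \<open>4 \<le> k\<close> matters: for \<open>k = 3\<close> the points 0
      and 2 form a convex set without a consecutive pair.\<close>
    consider "j = Suc i" | "i + 3 \<le> j" | "j = i + 2" "i + 3 < k" | "j = i + 2" "0 < i"
      using J(4) lt k by linarith
    then show ?thesis
    proof cases
      case 1
      then show ?thesis using J by auto
    next
      case 2
      have "Suc i \<in> J"
      proof (rule conv[OF J(2,3), of _ "odd i"])
        show "osc_rank (odd i) (Suc i) < osc_rank (odd i) j"
          using osc_rank_less[of "Suc i" j "odd i"] 2 by (auto split: if_splits)
      qed (use 2 lt in \<open>auto simp: osc_rank_def\<close>)
      then show ?thesis using J by auto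
    next
      case 3
      have "i + 3 \<in> J"
        by (rule conv[OF J(2,3), of _ "even i"]) (use 3 in \<open>auto simp: osc_rank_def\<close>)
      then show ?thesis using J(3) 3 by (auto simp: numeral_3_eq_3)
    next
      case 4
      have "i - 1 \<in> J"
        by (rule conv[OF J(2,3), of _ "odd i"]) (use 4 lt in \<open>auto simp: osc_rank_def\<close>)
      then show ?thesis using J(2) 4 by (intro exI[of _ "i - 1"]) auto
    qed
  qed
  then obtain a where a: "a \<in> J" "Suc a \<in> J" by blast
  have up: "a + l \<in> J \<and> Suc (a + l) \<in> J" if "Suc (a + l) < k" for l
    using that
  proof (induction l)
    case (Suc l)
    then show ?case using right[of "a + l"] by simp
  qed (use a in simp)
  have down: "a - l \<in> J \<and> Suc (a - l) \<in> J" if "l \<le> a" for l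
    using that
  proof (induction l)
    case (Suc l)
    then have "Suc (a - Suc l) = a - l" by simp
    then show ?case using left[of "a - l"] Suc by simp
  qed (use a in simp)
  have "l \<in> J" if "l < k" for l
  proof (cases "l \<le> a")
    case True
    then show ?thesis using down[of "a - l"] by simp
  next
    case False
    then show ?thesis using up[of "l - Suc a"] that by simp
  qed
  then show ?thesis using J(1) by blast
qed

section \<open>Pins and alternations\<close>

text \<open>An axis is a Boolean: \<open>c True\<close> is the position and \<open>c False\<close> the value of a point.
  A direction is an axis together with a sign \<open>1\<close> or \<open>-1\<close>.\<close>

locale plot =
  fixes n :: nat and c :: "bool \<Rightarrow> nat \<Rightarrow> int"
  assumes inj: "inj_on (c b) {..<n}"
begin

text \<open>For \<open>b\<close> true the points, listed by increasing value, alternate between left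
  and right of a vertical line; for \<open>b\<close> false this is the inverse picture.\<close>

definition alternates :: "nat \<Rightarrow> bool" where
  "alternates k \<longleftrightarrow> (\<exists>b t u. (\<forall>i<k. u i < n \<and> (c b (u i) < t \<longleftrightarrow> even i)) \<and>
     (\<forall>i j. i < j \<and> j < k \<longrightarrow> c (\<not> b) (u i) < c (\<not> b) (u j)))"

definition between :: "bool \<Rightarrow> nat \<Rightarrow> nat set \<Rightarrow> bool" where
  "between b q R \<longleftrightarrow> (\<exists>r\<in>R. \<exists>r'\<in>R. c b r < c b q \<and> c b q < c b r')"

definition hull :: "nat set \<Rightarrow> nat set" where
  "hull R = {q. q < n \<and> (\<forall>b. \<exists>r\<in>R. \<exists>r'\<in>R. c b r \<le> c b q \<and> c b q \<le> c b r')}"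

definition pin :: "bool \<Rightarrow> int \<Rightarrow> nat \<Rightarrow> nat set \<Rightarrow> bool" where
  "pin b s q R \<longleftrightarrow> q < n \<and> s \<in> {1, -1} \<and> between (\<not> b) q R \<and> (\<forall>r\<in>R. s * c b r < s * c b q)"

definition max_pin :: "bool \<Rightarrow> int \<Rightarrow> nat \<Rightarrow> nat set \<Rightarrow> bool" where
  "max_pin b s q R \<longleftrightarrow> pin b s q R \<and> (\<forall>q'. pin b s q' R \<longrightarrow> s * c b q' \<le> s * c b q)"

definition separates :: "bool \<Rightarrow> int \<Rightarrow> nat \<Rightarrow> nat \<Rightarrow> nat set \<Rightarrow> bool" where
  "separates b s q x R \<longleftrightarrow> s * c b q < s * c b x \<and> (\<forall>r\<in>R. s * c b r < s * c b q)"

inductive stage :: "nat set \<Rightarrow> nat set \<Rightarrow> bool" for e where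
  start: "stage e (hull e)"
| grow: "stage e R \<Longrightarrow> max_pin b s q R \<Longrightarrow> stage e (hull (insert q R))"

text \<open>The newest pin is the head. Maximality of \<open>x\<close> and its separation by the
  next pin \<open>q\<close> refer to the same \<open>R\<close>, so both are recorded when
  \<open>q\<close> is added. \<open>R\<close> may exceed \<open>e \<union> set ys\<close> because
  stages are hulls.\<close>

inductive pinseq :: "nat set \<Rightarrow> nat list \<Rightarrow> bool" for e where
  first: "q < n \<Longrightarrow> between b q e \<Longrightarrow> pinseq e [q]"
| next_pin: "pinseq e (x # ys) \<Longrightarrow> max_pin b s x R \<Longrightarrow> e \<union> set ys \<subseteq> R \<Longrightarrow> R \<subseteq> {..<n} \<Longrightarrow>
    q < n \<Longrightarrow> separates b s q x R \<Longrightarrow> pinseq e (q # x # ys)"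

text \<open>Maximality is forgotten and \<open>e\<close> shrinks to the single point
  \<open>y 0\<close>. The pair \<open>b l\<close>, \<open>s l\<close> is the direction of the pin
  \<open>y l\<close>, which is fixed only when a next pin separates \<open>y l\<close>.\<close>

definition pin_path :: "(nat \<Rightarrow> nat) \<Rightarrow> (nat \<Rightarrow> bool) \<Rightarrow> (nat \<Rightarrow> int) \<Rightarrow> nat \<Rightarrow> bool" where
  "pin_path y b s m \<longleftrightarrow> (\<forall>i\<le>m. y i < n) \<and>
     (\<forall>l. 0 < l \<and> l < m \<longrightarrow> s l \<in> {1, -1} \<and> separates (b l) (s l) (y (Suc l)) (y l) (y ` {..<l}))"

text \<open>One point is taken from each block, \<open>f\<close> from the even and \<open>g\<close>
  from the odd ones; the order inside a block is therefore irrelevant.\<close>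

lemma blocks_alternate_pos:
  assumes Q: "finite Q" "k \<le> card Q" "inj_on u Q"
    and pts: "\<And>x. x \<in> Q \<Longrightarrow> f x < n \<and> g x < n \<and> c b (f x) < t \<and> t < c b (g x)"
    and ord: "\<And>x x' y y'. x \<in> Q \<Longrightarrow> x' \<in> Q \<Longrightarrow> u x < (u x' :: int) \<Longrightarrow> y \<in> {f x, g x} \<Longrightarrow>
      y' \<in> {f x', g x'} \<Longrightarrow> c (\<not> b) y < c (\<not> b) y'"
  shows "alternates k"
proof -
  define L where "L = sorted_list_of_set (u ` Q)"
  have len: "length L = card Q" using Q by (simp add: L_def card_image)
  define e where "e i = the_inv_into Q u (L ! i)" for i
  have mem: "L ! i \<in> u ` Q" if "i < k" for i
    using that len Q by (metis L_def finite_imageI nth_mem order_less_le_trans set_sorted_list_of_set)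
  have eQ: "e i \<in> Q" "u (e i) = L ! i" if "i < k" for i
    using mem[OF that] Q unfolding e_def
    by (auto intro: the_inv_into_into f_the_inv_into_f)
  have mono: "u (e i) < u (e j)" if "i < j" "j < k" for i j
  proof -
    have "sorted_wrt (<) L" by (simp add: L_def)
    then have "L ! i < L ! j" using that len Q by (auto simp: sorted_wrt_iff_nth_less)
    then show ?thesis using eQ that by auto
  qed
  define w where "w i = (if even i then f (e i) else g (e i))" for i :: nat
  have "\<forall>i<k. w i < n \<and> (c b (w i) < t \<longleftrightarrow> even i)"
    using pts[OF eQ(1)] by (auto simp: w_def intro: less_trans dest: less_asym)
  moreover have "c (\<not> b) (w i) < c (\<not> b) (w j)" if "i < j" "j < k" for i j
    by (rule ord[of "e i" "e j"]) (use that mono eQ in \<open>auto simp: w_def\<close>)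
  ultimately show ?thesis unfolding alternates_def by blast
qed

lemma blocks_alternate:
  assumes Q: "finite Q" "k \<le> card Q" "inj_on u Q" and s: "s \<in> {1, -1 :: int}"
    and pts: "\<And>x. x \<in> Q \<Longrightarrow> f x < n \<and> g x < n \<and> s * c b (f x) < s * t \<and> s * t < s * c b (g x)"
    and ord: "\<And>x x' y y'. x \<in> Q \<Longrightarrow> x' \<in> Q \<Longrightarrow> u x < (u x' :: int) \<Longrightarrow> y \<in> {f x, g x} \<Longrightarrow>
      y' \<in> {f x', g x'} \<Longrightarrow> c (\<not> b) y < c (\<not> b) y'"
  shows "alternates k"
proof (cases "s = 1")
  case True
  show ?thesis
    by (rule blocks_alternate_pos[OF Q, of f g b t]) (use pts ord True in auto)
next
  case False
  then have s: "s = -1" using s by auto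
  show ?thesis
    by (rule blocks_alternate_pos[OF Q, of g f b t]) (use pts s ord in \<open>auto simp: insert_commute\<close>)
qed

section \<open>Hulls, stages and the extraction of pin sequences\<close>

lemma hull_subset: "hull R \<subseteq> {..<n}" by (auto simp: hull_def)

lemma subset_hull: "R \<subseteq> {..<n} \<Longrightarrow> R \<subseteq> hull R"
  by (fastforce simp: hull_def)

lemma hull_hull: "hull (hull R) \<subseteq> hull R"
  unfolding hull_def by (smt (verit, best) mem_Collect_eq subsetI)

lemma between_hull: "between b q (hull R) \<Longrightarrow> between b q R"
  unfolding between_def hull_def by (smt (verit, best) mem_Collect_eq)

lemma not_between_cases:
  assumes "q < n" "q \<notin> R" "R \<subseteq> {..<n}" "R \<noteq> {}" "\<not> between b q R"
  shows "\<exists>s\<in>{1, -1}. \<forall>r\<in>R. s * c b r < s * c b q"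
proof -
  have ne: "c b r \<noteq> c b q" if "r \<in> R" for r
    using inj[of b] assms that by (metis inj_on_def lessThan_iff subset_iff)
  show ?thesis
  proof (cases "\<exists>r\<in>R. c b r < c b q")
    case True
    then have "\<forall>r\<in>R. 1 * c b r < 1 * c b q"
      using assms(5) ne unfolding between_def by (metis linorder_neqE mult_1)
    then show ?thesis by blast
  next
    case False
    then have "\<forall>r\<in>R. -1 * c b r < -1 * c b q"
      using ne by (metis linorder_neqE mult_minus1 neg_less_iff_less)
    then show ?thesis by blast
  qed
qed

lemma stage_closed:
  assumes "stage e R" "e \<subseteq> {..<n}"
  shows "e \<subseteq> R \<and> R \<subseteq> {..<n} \<and> hull R \<subseteq> R"
  using assms
proof (induction)
  case start
  then show ?case using hull_subset subset_hull hull_hull by blast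
next
  case (grow R b s q)
  have "insert q R \<subseteq> {..<n}" using grow by (auto simp: max_pin_def pin_def)
  then show ?case using hull_subset subset_hull[of "insert q R"] hull_hull grow by blast
qed

text \<open>If \<open>q\<close> slices the stage obtained by adding the pin \<open>x\<close> to \<open>R\<close>, but not \<open>R\<close> itself, then it
  separates \<open>x\<close> from \<open>R\<close>; following these separations backwards gives the pin sequence.\<close>

lemma stage_pinseq:
  assumes "stage e R" "e \<subseteq> {..<n}" "e \<noteq> {}" "q < n" "q \<notin> R" "between a q R"
  shows "\<exists>ys. set ys \<subseteq> R \<and> pinseq e (q # ys)"
  using assms
proof (induction arbitrary: q a)
  case start
  then have "pinseq e [q]" using between_hull pinseq.first by metis
  then show ?case by (metis empty_set empty_subsetI)
next
  case (grow R b s x)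
  have cl: "e \<subseteq> R" "R \<subseteq> {..<n}" using stage_closed[OF grow.hyps(1)] grow.prems by auto
  have xp: "x < n" "s \<in> {1, -1}" "between (\<not> b) x R" "\<forall>r\<in>R. s * c b r < s * c b x"
    using grow.hyps(2) by (auto simp: max_pin_def pin_def)
  have sub: "insert x R \<subseteq> hull (insert x R)" using subset_hull[of "insert x R"] cl xp by auto
  have qR: "q \<notin> R" "q \<noteq> x" using grow.prems(4) sub by auto
  show ?case
  proof (cases "\<exists>a'. between a' q R")
    case True
    then obtain a' where "between a' q R" by blast
    then obtain ys where "set ys \<subseteq> R" "pinseq e (q # ys)"
      using grow.IH[OF grow.prems(1,2,3) qR(1)] by blast
    then show ?thesis using sub by blast
  next
    case False
    have "x \<notin> R" using xp(4) by blast
    then obtain ys where ys: "set ys \<subseteq> R" "pinseq e (x # ys)"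
      using grow.IH[OF grow.prems(1,2) xp(1)] xp(3) by blast
    have bt: "between a q (insert x R)" using grow.prems(5) between_hull by blast
    obtain s' where s': "s' \<in> {1, -1}" "\<forall>r\<in>R. s' * c a r < s' * c a q"
      using not_between_cases[OF grow.prems(3) qR(1) cl(2), of a] False cl grow.prems(2) by blast
    \<comment> \<open>Along \<open>a\<close>, \<open>q\<close> slices \<open>insert x R\<close> but
      lies outside \<open>R\<close>, so \<open>x\<close> lies farther out on the same side. Hence
      \<open>x\<close> does not slice \<open>R\<close> along \<open>a\<close>, which makes
      \<open>a\<close> and \<open>s'\<close> the direction of the pin \<open>x\<close>.\<close>
    have lt: "s' * c a q < s' * c a x"
      using bt s' unfolding between_def by (auto; fastforce)
    have "\<not> between a x R" using s' lt unfolding between_def by (auto; fastforce)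
    then have ab: "a = b" using xp(3) by (cases a; cases b; auto)
    obtain r where "r \<in> R" using cl grow.prems(2) by blast
    then have "s' * c b r < s' * c b x" "s * c b r < s * c b x" using s' lt xp ab by force+
    then have "s' = s" using s' xp(2) by auto
    then have "pinseq e (q # x # ys)"
      using ys grow.hyps(2) cl s' lt ab grow.prems(3)
      by (intro pinseq.next_pin[of e x ys b s R]) (auto simp: separates_def)
    then show ?thesis using ys sub by (metis insert_subset list.simps(15) order_trans)
  qed
qed


section \<open>Bounding the number of predecessors of a pin\<close>

text \<open>The possible predecessors of \<open>y\<close> in a pin sequence, over all sets
  \<open>R\<close>, so that counting them does not depend on the starting pair.\<close>

definition preds :: "bool \<Rightarrow> int \<Rightarrow> nat \<Rightarrow> nat set" where
  "preds b s y = {x. \<exists>R\<subseteq>{..<n}. max_pin b s x R \<and> separates b s y x R}"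

lemma preds_subset: "preds b s y \<subseteq> {..<n}"
  by (auto simp: preds_def max_pin_def pin_def)

text \<open>Without such a point \<open>z\<close>, both \<open>x\<close> and \<open>x'\<close> would be pins for each of the two sets
  that they slice, and the outer one would contradict the maximality of the other.\<close>

lemma preds_interleave:
  assumes x: "x \<in> preds b s y" "x' \<in> preds b s y" and lt: "c (\<not> b) x < c (\<not> b) x'"
  shows "\<exists>z<n. s * c b z < s * c b y \<and> c (\<not> b) x < c (\<not> b) z \<and> c (\<not> b) z < c (\<not> b) x'"
proof (rule ccontr)
  assume none: "\<not> ?thesis"
  obtain R R' where R: "R \<subseteq> {..<n}" "max_pin b s x R" "separates b s y x R"
    and R': "R' \<subseteq> {..<n}" "max_pin b s x' R'" "separates b s y x' R'"
    using x by (auto simp: preds_def)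
  have s: "s \<in> {1, -1}" and xn: "x < n" "x' < n"
    using R(2) R'(2) by (auto simp: max_pin_def pin_def)
  have low: "z < n \<and> s * c b z < s * c b y" if "z \<in> R \<union> R'" for z
    using that R R' by (auto simp: separates_def)
  have high: "s * c b y < s * c b x" "s * c b y < s * c b x'"
    using R R' by (auto simp: separates_def)
  have ne: "c (\<not> b) z \<noteq> c (\<not> b) x \<and> c (\<not> b) z \<noteq> c (\<not> b) x'" if "z \<in> R \<union> R'" for z
    using low[OF that] high xn inj[of "\<not> b"] by (metis inj_on_def lessThan_iff less_asym)
  have dich: "c (\<not> b) z < c (\<not> b) x \<or> c (\<not> b) x' < c (\<not> b) z" if "z \<in> R \<union> R'" for z
    using none low[OF that] ne[OF that] by force
  have "between (\<not> b) x R" "between (\<not> b) x' R'"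
    using R(2) R'(2) by (auto simp: max_pin_def pin_def)
  then have "between (\<not> b) x' R" "between (\<not> b) x R'"
    using dich lt unfolding between_def by (meson UnI1 UnI2 less_trans less_asym)+
  then have "pin b s x' R" "pin b s x R'"
    using s xn low high unfolding pin_def by (auto intro: less_trans)
  then have "s * c b x = s * c b x'"
    using R(2) R'(2) unfolding max_pin_def by (meson antisym)
  then have "c b x = c b x'" using s by auto
  then have "x = x'" using inj[of b] xn by (auto simp: inj_on_def)
  then show False using lt by simp
qed

text \<open>Each predecessor \<open>x\<close> is matched with the next point \<open>f x\<close>
  along the other axis among those on the near side of the line through \<open>y\<close>. It exists
  because \<open>x\<close> slices a set on that side, and \<open>preds_interleave\<close> places it
  before the next predecessor. The blocks thus straddle the line.\<close>

lemma card_preds: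
  assumes "\<not> alternates k" "s \<in> {1, -1}"
  shows "card (preds b s y) \<le> k"
proof (rule ccontr)
  assume big: "\<not> ?thesis"
  define low where "low x = {z. z < n \<and> s * c b z < s * c b y \<and> c (\<not> b) x < c (\<not> b) z}" for x
  define f where "f x = arg_min_on (c (\<not> b)) (low x)" for x
  have fin: "finite (low x)" for x by (simp add: low_def)
  have ne: "low x \<noteq> {}" if "x \<in> preds b s y" for x
  proof -
    obtain R where R: "R \<subseteq> {..<n}" "max_pin b s x R" "separates b s y x R"
      using \<open>x \<in> preds b s y\<close> by (auto simp: preds_def)
    then have "between (\<not> b) x R" by (auto simp: max_pin_def pin_def)
    then obtain r where "r \<in> R" "c (\<not> b) x < c (\<not> b) r" by (auto simp: between_def)
    then have "r \<in> low x" using R by (auto simp: low_def separates_def)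
    then show ?thesis by blast
  qed
  have f: "f x \<in> low x" if "x \<in> preds b s y" for x
    unfolding f_def by (rule arg_min_if_finite(1)[OF fin ne[OF that]])
  have fmin: "c (\<not> b) (f x) \<le> c (\<not> b) z" if "z \<in> low x" for x z
    unfolding f_def using arg_min_least[OF fin _ that] that by blast
  have flt: "c (\<not> b) (f x) < c (\<not> b) x'"
    if "x \<in> preds b s y" "x' \<in> preds b s y" "c (\<not> b) x < c (\<not> b) x'" for x x'
    using preds_interleave[OF that] fmin[of _ x] by (force simp: low_def)
  have "alternates k"
  proof (rule blocks_alternate[of "preds b s y" k "c (\<not> b)" s f id b "c b y"])
    show "finite (preds b s y)" by (rule finite_subset[OF preds_subset]) simp
    show "k \<le> card (preds b s y)" using big by simp
    show "inj_on (c (\<not> b)) (preds b s y)" by (rule inj_on_subset[OF inj preds_subset])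
    show "s \<in> {1, -1}" by fact
    show "f x < n \<and> id x < n \<and> s * c b (f x) < s * c b y \<and> s * c b y < s * c b (id x)"
      if "x \<in> preds b s y" for x
      using f[OF that] that preds_subset[of b s y] by (auto simp: low_def preds_def separates_def)
    show "c (\<not> b) v < c (\<not> b) v'"
      if "x \<in> preds b s y" "x' \<in> preds b s y" "c (\<not> b) x < c (\<not> b) x'" "v \<in> {f x, id x}"
        "v' \<in> {f x', id x'}" for x x' v v'
    proof -
      have "c (\<not> b) x' < c (\<not> b) (f x')" "c (\<not> b) x < c (\<not> b) (f x)"
        using f that by (auto simp: low_def)
      then show ?thesis using flt[OF that(1-3)] that by auto
    qed
  qed
  then show False using assms by blast
qed

section \<open>From pin sequences to oscillations\<close>

text \<open>The list is read backwards behind an arbitrary point of \<open>e\<close>. The conjuncts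
  about \<open>y\<close> serve the induction: they put all earlier points into the set
  \<open>R\<close> of the next step.\<close>

lemma pinseq_path:
  assumes "pinseq e L" "e \<subseteq> {..<n}"
  shows "\<exists>y b s. pin_path y b s (length L) \<and> y 0 \<in> e \<and> y (length L) = hd L \<and>
    y ` {0<..<length L} \<subseteq> set (tl L)"
  using assms
proof (induction)
  case (first q b)
  then obtain r where "r \<in> e" by (auto simp: between_def)
  then show ?case using first
    by (intro exI[of _ "\<lambda>i. if i = 0 then r else q"] exI) (auto simp: pin_path_def)
next
  case (next_pin x ys b s R q)
  define m where "m = length (x # ys)"
  obtain y b' s' where y: "pin_path y b' s' m" "y 0 \<in> e" "y m = x" "y ` {0<..<m} \<subseteq> set ys"
    using next_pin.IH next_pin.prems by (auto simp: m_def)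
  have "y ` {..<m} \<subseteq> R"
  proof
    fix z assume "z \<in> y ` {..<m}"
    then obtain i where "i < m" "z = y i" by blast
    then have "z = y 0 \<or> z \<in> y ` {0<..<m}" by (cases "i = 0") auto
    then show "z \<in> R" using y(2,4) next_pin.hyps(3) by blast
  qed
  then have sep: "separates b s q x (y ` {..<m})"
    using next_pin.hyps(6) unfolding separates_def by blast
  have s: "s \<in> {1, -1}" using next_pin.hyps(2) by (auto simp: max_pin_def pin_def)
  let ?y = "y(Suc m := q)"
  have im: "?y ` {..<l} = y ` {..<l}" if "l \<le> m" for l
    using that by (intro image_cong) auto
  have "pin_path ?y (b'(m := b)) (s'(m := s)) (Suc m)"
    unfolding pin_path_def
  proof (intro conjI allI impI)
    fix i assume "i \<le> Suc m"
    then show "?y i < n" using y(1) next_pin.hyps(5) by (auto simp: pin_path_def)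
  next
    fix l assume l: "0 < l \<and> l < Suc m"
    then show "(s'(m := s)) l \<in> {1, -1}" using s y(1) by (auto simp: pin_path_def)
    show "separates ((b'(m := b)) l) ((s'(m := s)) l) (?y (Suc l)) (?y l) (?y ` {..<l})"
    proof (cases "l = m")
      case True
      then show ?thesis using sep y(3) im[of m] by simp
    next
      case False
      then show ?thesis using l y(1) im[of l] by (auto simp: pin_path_def)
    qed
  qed
  moreover have "?y ` {0<..<Suc m} \<subseteq> set (x # ys)"
  proof
    fix z assume "z \<in> ?y ` {0<..<Suc m}"
    then obtain i where "0 < i" "i \<le> m" "z = y i" by auto
    then have "z = y m \<or> z \<in> y ` {0<..<m}" by (cases "i = m") auto
    then show "z \<in> set (x # ys)" using y(3,4) by auto
  qed
  moreover have "?y 0 \<in> e" "?y (Suc m) = q" using y(2) by auto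
  ultimately show ?case
    by (intro exI[of _ ?y] exI[of _ "b'(m := b)"] exI[of _ "s'(m := s)"])
      (simp add: m_def del: fun_upd_apply)
qed

context
  fixes y b s m
  assumes path: "pin_path y b s m"
begin

lemma path_lt: "i \<le> m \<Longrightarrow> y i < n"
  using path by (simp add: pin_path_def)

lemma path_sign: "0 < l \<Longrightarrow> l < m \<Longrightarrow> s l = 1 \<or> s l = -1"
  using path by (auto simp: pin_path_def)

lemma path_behind: "0 < l \<Longrightarrow> l < m \<Longrightarrow> s l * c (b l) (y (Suc l)) < s l * c (b l) (y l)"
  using path by (auto simp: pin_path_def separates_def)

lemma path_beyond:
  assumes "0 < l" "l < m" "i < l" "v \<in> {y l, y (Suc l)}"
  shows "s l * c (b l) (y i) < s l * c (b l) v"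
proof -
  have "s l * c (b l) (y i) < s l * c (b l) (y (Suc l))"
    using path assms by (auto simp: pin_path_def separates_def)
  then show ?thesis using path_behind[OF assms(1,2)] assms(4) by auto
qed

text \<open>On the axis of pin \<open>l\<close>, \<open>y (Suc l)\<close> lies strictly between
  \<open>y 0\<close> and \<open>y l\<close>. With the same axis at \<open>Suc l\<close>, it would
  also lie beyond both of them on one side.\<close>

lemma path_axis:
  assumes "0 < l" "Suc l < m"
  shows "b (Suc l) = (\<not> b l)"
proof (rule ccontr)
  assume "\<not> ?thesis"
  then have eq: "b (Suc l) = b l" by auto
  have 1: "s l * c (b l) (y 0) < s l * c (b l) (y (Suc l))" "s l * c (b l) (y (Suc l)) < s l * c (b l) (y l)"
    using path_beyond[of l 0 "y (Suc l)"] path_behind[of l] assms by auto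
  have 2: "s (Suc l) * c (b l) (y i) < s (Suc l) * c (b l) (y (Suc l))" if "i \<in> {0, l}" for i
    using path_beyond[of "Suc l" i "y (Suc l)"] assms that eq by auto
  show False
    using 1 2[of 0] 2[of l] path_sign[of l] path_sign[of "Suc l"] assms by auto
qed

text \<open>A change of side between the pins \<open>l - 1\<close> and \<open>l + 1\<close> puts \<open>y l\<close> and \<open>y (l + 1)\<close>
  on different sides of \<open>y 0\<close>; such pairs for pins \<open>l\<close> in the same direction are stacked in order.\<close>

lemma changes_alternate:
  assumes "4 * k \<le> card {l. 2 \<le> l \<and> Suc l < m \<and> s (l - 1) \<noteq> s (Suc l)}" (is "_ \<le> card ?C")
  shows "alternates k"
proof -
  let ?D = "{(True, 1), (True, -1), (False, 1), (False, -1 :: int)}"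
  let ?Q = "\<lambda>d. {l \<in> ?C. b l = fst d \<and> s l = snd d}"
  have finC: "finite ?C" by (rule finite_subset[of _ "{..<m}"]) auto
  \<comment> \<open>Pigeonhole over the four directions explains the factor 4.\<close>
  have "\<exists>d\<in>?D. k \<le> card (?Q d)"
  proof (rule ccontr)
    assume "\<not> ?thesis"
    then have small: "card (?Q d) < k" if "d \<in> ?D" for d using that not_le by blast
    have "?C \<subseteq> (\<Union>d\<in>?D. ?Q d)"
    proof
      fix l assume "l \<in> ?C"
      moreover from this have "(b l, s l) \<in> ?D" using path_sign[of l] by (cases "b l") auto
      ultimately show "l \<in> (\<Union>d\<in>?D. ?Q d)" by force
    qed
    then have "card ?C \<le> card (\<Union>d\<in>?D. ?Q d)"
      by (intro card_mono finite_UN_I) (auto intro: finite_subset[OF _ finC])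
    also have "\<dots> \<le> (\<Sum>d\<in>?D. card (?Q d))" by (rule card_UN_le) simp
    also have "\<dots> < 4 * k"
      using small[of "(True, 1)"] small[of "(True, -1)"] small[of "(False, 1)"] small[of "(False, -1)"]
      by simp
    finally show False using assms by simp
  qed
  then obtain d where D: "d \<in> ?D" "k \<le> card (?Q d)" by blast
  obtain \<beta> \<sigma> where ds: "d = (\<beta>, \<sigma>)" by (cases d)
  have d: "(\<beta>, \<sigma>) \<in> ?D" "k \<le> card (?Q (\<beta>, \<sigma>))" using D unfolding ds by blast+
  define Q where "Q = ?Q (\<beta>, \<sigma>)"
  have Q: "2 \<le> l" "Suc l < m" "s (l - 1) \<noteq> s (Suc l)" "b l = \<beta>" "s l = \<sigma>" if "l \<in> Q" for l
    using that by (auto simp: Q_def)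
  define a where "a = (\<not> \<beta>)"
  define t where "t = c a (y 0)"
  define f where "f l = (if c a (y l) < t then y l else y (Suc l))" for l
  define g where "g l = (if c a (y l) < t then y (Suc l) else y l)" for l
  \<comment> \<open>Axes alternate, so equal directions are at least two steps apart; both points of
    the later block then lie beyond both points of the earlier one.\<close>
  have below: "\<sigma> * c \<beta> v < \<sigma> * c \<beta> v'"
    if "l \<in> Q" "l' \<in> Q" "l < l'" "v \<in> {y l, y (Suc l)}" "v' \<in> {y l', y (Suc l')}" for l l' v v'
  proof -
    have "l' \<noteq> Suc l" using path_axis[of l] Q[OF that(1)] Q[OF that(2)] by auto
    then have "Suc l < l'" using that by simp
    then show ?thesis
      using path_beyond[of l' l v'] path_beyond[of l' "Suc l" v'] Q[OF that(2)] that by auto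
  qed
  \<comment> \<open>The blocks are stacked outwards in direction \<open>\<sigma>\<close>, so for
    \<open>\<sigma> = -1\<close> later indices come first along the axis.\<close>
  show ?thesis
  proof (rule blocks_alternate_pos[of Q k "\<lambda>l. \<sigma> * int l" f g a t])
    show "finite Q" using finC unfolding Q_def by (rule rev_finite_subset) auto
    show "k \<le> card Q" using d(2) by (simp add: Q_def)
    show "inj_on (\<lambda>l. \<sigma> * int l) Q" using d(1) by (auto simp: inj_on_def)
    show "f l < n \<and> g l < n \<and> c a (f l) < t \<and> t < c a (g l)" if "l \<in> Q" for l
    proof -
      note l = Q[OF that]
      \<comment> \<open>On axis \<open>a\<close>, \<open>y l\<close> separates pin
        \<open>l - 1\<close> from \<open>y 0\<close> and so lies on side \<open>s (l - 1)\<close> of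
        it, while \<open>y (Suc l)\<close> lies on its own side \<open>s (Suc l)\<close>.\<close>
      have "b (l - 1) = a" "b (Suc l) = a"
        using path_axis[of "l - 1"] path_axis[of l] l path_axis[of "Suc l"] by (auto simp: a_def)
      then have "s (l - 1) * t < s (l - 1) * c a (y l)" "s (Suc l) * t < s (Suc l) * c a (y (Suc l))"
        using path_beyond[of "l - 1" 0 "y l"] path_beyond[of "Suc l" 0 "y (Suc l)"] l
        by (auto simp: t_def)
      then show ?thesis
        using path_sign[of "l - 1"] path_sign[of "Suc l"] l path_lt[of l] path_lt[of "Suc l"]
        by (auto simp: f_def g_def)
    qed
    show "c (\<not> a) v < c (\<not> a) v'"
      if "l \<in> Q" "l' \<in> Q" "\<sigma> * int l < \<sigma> * int l'" "v \<in> {f l, g l}" "v' \<in> {f l', g l'}" for l l' v v'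
    proof -
      have v: "v \<in> {y l, y (Suc l)}" "v' \<in> {y l', y (Suc l')}"
        using that by (auto simp: f_def g_def split: if_splits)
      show ?thesis
        using below[OF that(1,2) _ v] below[OF that(2,1) _ v(2,1)] that(3) d(1) by (auto simp: a_def)
    qed
  qed
qed

end

section \<open>Oscillations from stretches without a change of side\<close>

text \<open>These are the comparisons of \<open>osc_rank_less\<close>, up to a reflection
  \<open>\<sigma> b\<close> of each axis.\<close>

definition oscillates :: "nat \<Rightarrow> bool" where
  "oscillates k \<longleftrightarrow> (\<exists>w \<sigma>. (\<forall>i<k. w i < n) \<and> (\<forall>b. \<sigma> b \<in> {1, -1}) \<and>
     (\<forall>i j b. i < j \<and> j < k \<longrightarrow>
        (if Suc i = j \<and> b = odd j then \<sigma> b * c b (w j) < \<sigma> b * c b (w i)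
         else \<sigma> b * c b (w i) < \<sigma> b * c b (w j))))"

text \<open>Reversing the order of an even number of points negates both signs, so the sign of the
  value axis may be assumed to be \<open>1\<close>.\<close>

lemma oscillates_rank:
  assumes "even k" "oscillates k"
  shows "\<exists>w \<sigma>. (\<forall>i<k. w i < n) \<and> \<sigma> \<in> {1, -1} \<and> (\<forall>i<k. \<forall>j<k.
    (\<sigma> * c True (w i) < \<sigma> * c True (w j) \<longleftrightarrow> osc_rank True i < osc_rank True j) \<and>
    (c False (w i) < c False (w j) \<longleftrightarrow> osc_rank False i < osc_rank False j))"
proof -
  let ?P = "\<lambda>w \<sigma>. (\<forall>i<k. w i < n) \<and> (\<forall>b. \<sigma> b \<in> {1, -1}) \<and>
     (\<forall>i j b. i < j \<and> j < k \<longrightarrow>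
        (if Suc i = j \<and> b = odd j then \<sigma> b * c b (w j) < \<sigma> b * c b (w i)
         else \<sigma> b * c b (w i) < \<sigma> b * c b (w j)))"
  obtain w \<sigma> where w: "?P w \<sigma>" using assms(2) unfolding oscillates_def by blast
  have "\<exists>w \<sigma>. ?P w \<sigma> \<and> \<sigma> False = 1"
  proof (cases "\<sigma> False = 1")
    case False
    then have "\<sigma> False = -1" using w by auto
    then have one: "- \<sigma> False = 1" by simp
    have P: "?P (\<lambda>i. w (k - 1 - i)) (\<lambda>b. - \<sigma> b)"
    proof (intro conjI allI impI)
      fix i assume "i < k"
      then show "w (k - 1 - i) < n" using w by auto
    next
      fix b show "- \<sigma> b \<in> {1, -1}" using w by force
    next
      fix i j b assume ij: "i < j \<and> j < k"
      let ?i = "k - 1 - j" and ?j = "k - 1 - i"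
      have "?i < ?j \<and> ?j < k" using ij by auto
      then have "if Suc ?i = ?j \<and> b = odd ?j then \<sigma> b * c b (w ?j) < \<sigma> b * c b (w ?i)
         else \<sigma> b * c b (w ?i) < \<sigma> b * c b (w ?j)" using w by blast
      moreover have "Suc ?i = ?j \<longleftrightarrow> Suc i = j" using ij by auto
      \<comment> \<open>Here \<open>?j = k - j\<close>, which has the parity of \<open>j\<close>
        because \<open>k\<close> is even.\<close>
      moreover have "odd ?j \<longleftrightarrow> odd j" if "Suc i = j" using ij that assms(1) by auto
      ultimately show "if Suc i = j \<and> b = odd j then - \<sigma> b * c b (w ?i) < - \<sigma> b * c b (w ?j)
         else - \<sigma> b * c b (w ?j) < - \<sigma> b * c b (w ?i)"
        by (cases "Suc i = j"; cases "b = odd j") auto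
    qed
    show ?thesis
      by (rule exI[of _ "\<lambda>i. w (k - 1 - i)"], rule exI[of _ "\<lambda>b. - \<sigma> b"], rule conjI, rule P, rule one)
  qed (use w in blast)
  then obtain w \<sigma> where w: "?P w \<sigma>" and s: "\<sigma> False = 1" by blast
  have cmp: "if Suc i = j \<and> b = odd j then \<sigma> b * c b (w j) < \<sigma> b * c b (w i)
    else \<sigma> b * c b (w i) < \<sigma> b * c b (w j)" if "i < j" "j < k" for i j b
    using w that by blast
  have "\<sigma> b * c b (w i) < \<sigma> b * c b (w j) \<longleftrightarrow> osc_rank b i < osc_rank b j" if "i < k" "j < k" for i j b
  proof (cases i j rule: linorder_cases)
    case less
    then show ?thesis using cmp[OF less, of b] osc_rank_less[OF less, of b] that
      by (cases "Suc i = j \<and> b = odd j") auto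
  next
    case greater
    then show ?thesis using cmp[OF greater, of b] osc_rank_less[OF greater, of b] that
      by (cases "Suc j = i \<and> b = odd i") auto
  qed simp
  from this[of _ _ True] this[of _ _ False] show ?thesis
    using w s by (intro exI[of _ w] exI[of _ "\<sigma> True"]) auto
qed

text \<open>A pin lies beyond all earlier points on its own axis. On the other axis it lies just
  behind its predecessor but beyond all the others, which gives the swaps of neighbours.\<close>

lemma constant_window_oscillates:
  assumes path: "pin_path y b s m" and a: "2 \<le> a" "a + k < m"
    and const: "\<And>l. a \<le> l \<Longrightarrow> l < a + k \<Longrightarrow> s (l - 1) = s (Suc l)"
  shows "oscillates k"
proof (cases "k \<le> 1")
  case True
  then show ?thesis using path_lt[OF path, of 0] unfolding oscillates_def
    by (intro exI[of _ "\<lambda>_. y 0"] exI[of _ "\<lambda>_. 1"]) auto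
next
  case False
  \<comment> \<open>A shift by at most one makes the stretch start with a horizontal pin, so that
    points 0 and 1 are swapped in position.\<close>
  define a' where "a' = (if b a then a else Suc a)"
  have a': "2 \<le> a'" "a \<le> a'" "a' + k \<le> m" "a' \<le> Suc a" using a by (auto simp: a'_def)
  have b0: "b a'" using path_axis[OF path, of a] a False by (auto simp: a'_def)
  have bj: "b (a' + j) = even j" if "j < k" for j
    using that
  proof (induction j)
    case (Suc j)
    then show ?case using path_axis[OF path, of "a' + j"] a' by auto
  qed (use b0 in simp)
  define \<sigma> where "\<sigma> \<beta> = (if \<beta> then s a' else s (Suc a'))" for \<beta>
  have sj: "s (a' + j) = \<sigma> (even j)" if "j < k" for j
    using that
  proof (induction j rule: less_induct)
    case (less j)
    consider "j = 0" | "j = 1" | i where "j = Suc (Suc i)" by (metis One_nat_def not0_implies_Suc)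
    then show ?case
    proof cases
      case 3
      then have "s (a' + i) = s (a' + j)" using const[of "Suc (a' + i)"] less.prems a' by simp
      then show ?thesis using less.IH[of i] less.prems 3 by simp
    qed (auto simp: \<sigma>_def)
  qed
  define w where "w i = y (a' + i)" for i
  have sg: "\<sigma> \<beta> \<in> {1, -1}" for \<beta>
    using path_sign[OF path, of a'] path_sign[OF path, of "Suc a'"] a' False by (auto simp: \<sigma>_def)
  have "if Suc i = j \<and> \<beta> = odd j then \<sigma> \<beta> * c \<beta> (w j) < \<sigma> \<beta> * c \<beta> (w i)
         else \<sigma> \<beta> * c \<beta> (w i) < \<sigma> \<beta> * c \<beta> (w j)" if ij: "i < j" "j < k" for i j \<beta>
  proof (cases "\<beta> = even j")
    case True
    then show ?thesis
      using path_beyond[OF path, of "a' + j" "a' + i" "w j"] ij a' bj[of j] sj[of j]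
      by (auto simp: w_def)
  next
    case False
    obtain j' where j': "j = Suc j'" using ij by (cases j) auto
    have e: "even j' = \<beta>" using False j' by auto
    show ?thesis
      using path_beyond[OF path, of "a' + j'" "a' + i" "w j"] path_behind[OF path, of "a' + j'"]
        ij a' bj[of j'] sj[of j'] j' e False
      by (cases "i = j'") (auto simp: w_def)
  qed
  moreover have "\<forall>i<k. w i < n" using path_lt[OF path] a' by (auto simp: w_def)
  ultimately show ?thesis using sg unfolding oscillates_def by blast
qed

lemma max_pin_exists:
  assumes "pin b s q R"
  shows "\<exists>q'. max_pin b s q' R"
proof -
  let ?A = "{q. pin b s q R}"
  have "finite ?A" by (rule finite_subset[of _ "{..<n}"]) (auto simp: pin_def)
  moreover have "?A \<noteq> {}" using assms by blast
  ultimately obtain m where "m \<in> ?A" "\<And>x. x \<in> ?A \<Longrightarrow> s * c b x \<le> s * c b m"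
    using finite_has_maximizer[of ?A "\<lambda>x. s * c b x"] by metis
  then show ?thesis unfolding max_pin_def by blast
qed

end

section \<open>Long pin sequences\<close>

locale sliced_plot = plot +
  assumes horizontal: "c True i = int i"
    and sliced: "\<And>R. R \<subset> {..<n} \<Longrightarrow> 2 \<le> card R \<Longrightarrow> \<exists>b. \<exists>q\<in>{..<n} - R. between b q R"
begin

text \<open>A slicing entry outside a closed \<open>R\<close> is outside its hull, so on the other
  axis it lies beyond \<open>R\<close> and is a pin.\<close>

lemma closed_has_max_pin:
  assumes R: "R \<subset> {..<n}" "2 \<le> card R" "hull R \<subseteq> R"
  shows "\<exists>b s q. max_pin b s q R"
proof -
  obtain a q where q: "q < n" "q \<notin> R" "between a q R" using sliced[OF R(1,2)] by auto
  have "R \<noteq> {}" using R(2) by auto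
  have "q \<notin> hull R" using q R by blast
  then obtain b where b: "\<not> (\<exists>r\<in>R. \<exists>r'\<in>R. c b r \<le> c b q \<and> c b q \<le> c b r')"
    using q by (auto simp: hull_def)
  then have nb: "\<not> between b q R" unfolding between_def by (meson less_imp_le)
  then have "a = (\<not> b)" using q(3) by (cases a; cases b; auto)
  moreover obtain s where "s \<in> {1, -1}" "\<forall>r\<in>R. s * c b r < s * c b q"
    using not_between_cases[OF q(1,2) _ \<open>R \<noteq> {}\<close> nb] R(1) by blast
  ultimately have "pin b s q R" using q by (simp add: pin_def)
  then show ?thesis using max_pin_exists by blast
qed

lemma last_pinseq:
  assumes e: "e \<subseteq> {..<n - 1}" "2 \<le> card e"
  shows "\<exists>ys. pinseq e ((n - 1) # ys)"
proof -
  have en: "e \<subseteq> {..<n}" using e by auto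
  have ne: "e \<noteq> {}" using e by auto
  have n: "0 < n" using e ne by (cases n) auto
  \<comment> \<open>Nothing lies to the right of the last position, so a hull contains it only as
    one of the generating points.\<close>
  have z: "n - 1 \<in> insert q R" if "n - 1 \<in> hull (insert q R)" "R \<subseteq> {..<n}" "q < n" for q R
  proof -
    have "\<forall>b. \<exists>r'\<in>insert q R. c b (n - 1) \<le> c b r'"
      using that(1) unfolding hull_def by blast
    then obtain r' where "r' \<in> insert q R" "c True (n - 1) \<le> c True r'" by blast
    moreover from this have "r' < n" using that by auto
    ultimately have "r' = n - 1" using horizontal by simp
    then show ?thesis using \<open>r' \<in> insert q R\<close> by simp
  qed
  \<comment> \<open>A largest stage missing \<open>n - 1\<close> still has a pin; adding it must
    bring in \<open>n - 1\<close>, so this pin is \<open>n - 1\<close> itself.\<close>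
  let ?S = "{R. stage e R \<and> n - 1 \<notin> R}"
  have sub: "R \<subseteq> {..<n}" if "stage e R" for R using stage_closed[OF that en] by blast
  have "?S \<subseteq> Pow {..<n}" using sub by blast
  then have fin: "finite ?S" using finite_subset by blast
  obtain a where a: "a \<in> e" using ne by blast
  have "n - 1 \<notin> hull e"
  proof
    assume "n - 1 \<in> hull e"
    then have "n - 1 \<in> insert a e" using z[of a e] a en by (auto simp: insert_absorb)
    then show False using a e by auto
  qed
  then have "hull e \<in> ?S" using stage.start by blast
  then obtain R where R: "R \<in> ?S" and mx: "\<And>R'. R' \<in> ?S \<Longrightarrow> card R' \<le> card R"
    using finite_has_maximizer[OF fin, of card] by blast
  have cl: "e \<subseteq> R" "R \<subseteq> {..<n}" "hull R \<subseteq> R" using stage_closed R en by blast+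
  have finR: "finite R" using cl(2) finite_subset by blast
  have "2 \<le> card R" using e(2) card_mono[OF finR cl(1)] by simp
  moreover have "R \<subset> {..<n}" using R n cl(2) by auto
  ultimately obtain b s q where q: "max_pin b s q R" using closed_has_max_pin[of R] cl(3) by blast
  have qn: "q < n" "q \<notin> R" using q by (auto simp: max_pin_def pin_def)
  let ?R' = "hull (insert q R)"
  have st: "stage e ?R'" using stage.grow[OF _ q] R by blast
  have "insert q R \<subseteq> ?R'" using subset_hull[of "insert q R"] cl qn by auto
  then have "card (insert q R) \<le> card ?R'"
    using card_mono[OF finite_subset[OF sub[OF st]]] by blast
  then have "card R < card ?R'" using qn finR by simp
  then have "n - 1 \<in> ?R'" using mx[of ?R'] st by auto
  then have "n - 1 = q" using z[OF _ cl(2) qn(1)] R by auto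
  then have "between (\<not> b) (n - 1) R" using q by (auto simp: max_pin_def pin_def)
  then show ?thesis using stage_pinseq[of e R "n - 1"] R en ne n by auto
qed

text \<open>Disjoint pairs of adjacent positions: no entry slices such a pair by position, and
  different pairs are ordered as blocks.\<close>

definition base :: "nat \<Rightarrow> nat set" where "base j = {2 * j, Suc (2 * j)}"

text \<open>The pairs sliced by \<open>q\<close> each have one entry below and one above it, and run
  from left to right.\<close>

lemma card_base_sliced:
  assumes "\<not> alternates k"
  shows "card {j. base j \<subseteq> {..<n} \<and> between b q (base j)} \<le> k" (is "card ?Q \<le> k")
proof (rule ccontr)
  assume big: "\<not> ?thesis"
  have fin: "finite ?Q" by (rule finite_subset[of _ "{..<n}"]) (auto simp: base_def)
  have b: "b = False"
  proof (rule ccontr)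
    assume "b \<noteq> False"
    then have "?Q = {}" by (auto simp: base_def between_def horizontal)
    then have "card ?Q = 0" by (simp only: card.empty)
    then show False using big by linarith
  qed
  define f where "f j = (if c b (2 * j) < c b q then 2 * j else Suc (2 * j))" for j
  define g where "g j = (if c b (2 * j) < c b q then Suc (2 * j) else 2 * j)" for j
  have "alternates k"
  proof (rule blocks_alternate_pos[of ?Q k int f g b "c b q"])
    show "f x < n \<and> g x < n \<and> c b (f x) < c b q \<and> c b q < c b (g x)" if "x \<in> ?Q" for x
      using that by (auto simp: f_def g_def base_def between_def)
    show "c (\<not> b) y < c (\<not> b) y'"
      if "x \<in> ?Q" "x' \<in> ?Q" "int x < int x'" "y \<in> {f x, g x}" "y' \<in> {f x', g x'}" for x x' y y'
      using that b by (auto simp: horizontal f_def g_def)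
  qed (use big fin in auto)
  then show False using assms by blast
qed

text \<open>The recurrence is \<open>T (l + 1) \<le> 2 * k + 4 * k * T l\<close>: either
  \<open>y\<close> slices the pair along one of two axes, or it has one of at most \<open>k\<close>
  predecessors in one of four directions.\<close>

lemma card_short_pinseq:
  assumes na: "\<not> alternates k"
  shows "card {j. base j \<subseteq> {..<n} \<and> (\<exists>ys. length ys < l \<and> pinseq (base j) (y # ys))}
    \<le> 2 * k * (\<Sum>i<l. (4 * k) ^ i)"
proof (induction l arbitrary: y)
  case 0
  then show ?case by simp
next
  case (Suc l)
  let ?S = "\<lambda>l y. {j. base j \<subseteq> {..<n} \<and> (\<exists>ys. length ys < l \<and> pinseq (base j) (y # ys))}"
  let ?B = "\<lambda>b. {j. base j \<subseteq> {..<n} \<and> between b y (base j)}"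
  let ?D = "{(True, 1), (True, -1), (False, 1), (False, -1 :: int)}"
  have fin: "finite (?S l y)" "finite (?B b)" for l y b
    by (rule finite_subset[of _ "{..<n}"]; auto simp: base_def)+
  have finp: "finite (preds b s y)" for b s by (rule finite_subset[OF preds_subset]) simp
  have "?S (Suc l) y \<subseteq> (?B True \<union> ?B False) \<union> (\<Union>d\<in>?D. \<Union>x\<in>preds (fst d) (snd d) y. ?S l x)"
  proof
    fix j assume "j \<in> ?S (Suc l) y"
    then obtain ys where j: "base j \<subseteq> {..<n}" "length ys < Suc l" "pinseq (base j) (y # ys)" by blast
    from j(3) show "j \<in> (?B True \<union> ?B False) \<union> (\<Union>d\<in>?D. \<Union>x\<in>preds (fst d) (snd d) y. ?S l x)"
    proof cases
      case (first b)
      then show ?thesis using j(1) by (cases b) auto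
    next
      case (next_pin x ys' b s R)
      then have "x \<in> preds b s y" by (auto simp: preds_def)
      moreover have "(b, s) \<in> ?D" using next_pin by (auto simp: max_pin_def pin_def)
      moreover have "j \<in> ?S l x" using next_pin j by auto
      ultimately show ?thesis by force
    qed
  qed
  then have "card (?S (Suc l) y)
    \<le> card ((?B True \<union> ?B False) \<union> (\<Union>d\<in>?D. \<Union>x\<in>preds (fst d) (snd d) y. ?S l x))"
    by (intro card_mono finite_UnI finite_UN_I fin finp) auto
  also have "\<dots> \<le> (card (?B True) + card (?B False)) + card (\<Union>d\<in>?D. \<Union>x\<in>preds (fst d) (snd d) y. ?S l x)"
    by (meson add_mono card_Un_le le_refl order_trans)
  also have "\<dots> \<le> (k + k) + (\<Sum>d\<in>?D. k * (2 * k * (\<Sum>i<l. (4 * k) ^ i)))"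
  proof (intro add_mono card_base_sliced[OF na])
    have "card (\<Union>d\<in>?D. \<Union>x\<in>preds (fst d) (snd d) y. ?S l x)
      \<le> (\<Sum>d\<in>?D. card (\<Union>x\<in>preds (fst d) (snd d) y. ?S l x))"
      by (rule card_UN_le) simp
    also have "\<dots> \<le> (\<Sum>d\<in>?D. k * (2 * k * (\<Sum>i<l. (4 * k) ^ i)))"
    proof (rule sum_mono)
      fix d assume d: "d \<in> ?D"
      have "card (\<Union>x\<in>preds (fst d) (snd d) y. ?S l x) \<le> (\<Sum>x\<in>preds (fst d) (snd d) y. card (?S l x))"
        by (rule card_UN_le[OF finp])
      also have "\<dots> \<le> card (preds (fst d) (snd d) y) * (2 * k * (\<Sum>i<l. (4 * k) ^ i))"
        using sum_bounded_above[of "preds (fst d) (snd d) y" "\<lambda>x. card (?S l x)"] Suc.IH by simp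
      also have "\<dots> \<le> k * (2 * k * (\<Sum>i<l. (4 * k) ^ i))"
        by (intro mult_right_mono card_preds[OF na]) (use d in auto)
      finally show "card (\<Union>x\<in>preds (fst d) (snd d) y. ?S l x) \<le> k * (2 * k * (\<Sum>i<l. (4 * k) ^ i))" .
    qed
    finally show "card (\<Union>d\<in>?D. \<Union>x\<in>preds (fst d) (snd d) y. ?S l x)
      \<le> (\<Sum>d\<in>?D. k * (2 * k * (\<Sum>i<l. (4 * k) ^ i)))" .
  qed
  also have "\<dots> = 2 * k * (\<Sum>i<Suc l. (4 * k) ^ i)"
    by (simp add: sum.lessThan_Suc_shift sum_distrib_left algebra_simps del: sum.lessThan_Suc)
  finally show ?case .
qed

lemma long_pinseq:
  assumes na: "\<not> alternates k" and n: "2 * (2 * k * (\<Sum>i<l. (4 * k) ^ i)) + 5 \<le> n"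
  shows "\<exists>j z ys. base j \<subseteq> {..<n} \<and> l \<le> length ys \<and> pinseq (base j) (z # ys)"
proof (rule ccontr)
  assume none: "\<not> ?thesis"
  let ?S = "{j. base j \<subseteq> {..<n} \<and> (\<exists>ys. length ys < l \<and> pinseq (base j) ((n - 1) # ys))}"
  let ?M = "2 * k * (\<Sum>i<l. (4 * k) ^ i)"
  \<comment> \<open>The pairs 0 to \<open>?M\<close> end at position \<open>2 * ?M + 1\<close>,
    below \<open>n - 1\<close>; they are one more than short sequences can account for.\<close>
  have "{..?M} \<subseteq> ?S"
  proof
    fix j assume "j \<in> {..?M}"
    then have "base j \<subseteq> {..<n - 1}" using n by (auto simp: base_def)
    moreover have "2 \<le> card (base j)" by (simp add: base_def)
    ultimately obtain ys where "pinseq (base j) ((n - 1) # ys)" using last_pinseq by blast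
    moreover have "base j \<subseteq> {..<n}" using \<open>base j \<subseteq> {..<n - 1}\<close> by auto
    ultimately show "j \<in> ?S" using none not_le by blast
  qed
  moreover have "finite ?S" by (rule finite_subset[of _ "{..<n}"]) (auto simp: base_def)
  ultimately have "card {..?M} \<le> card ?S" using card_mono by blast
  then show False using card_short_pinseq[OF na, of l "n - 1"] by simp
qed

lemma alternates_or_oscillates:
  assumes n: "2 * (2 * k * (\<Sum>i<4 * k * w + 3. (4 * k) ^ i)) + 5 \<le> n"
  shows "alternates k \<or> oscillates w"
proof (cases "alternates k")
  case False
  then have na: "\<not> alternates k" .
  obtain j z ys where ps: "base j \<subseteq> {..<n}" "4 * k * w + 3 \<le> length ys" "pinseq (base j) (z # ys)"
    using long_pinseq[OF na n] by blast
  define m where "m = length (z # ys)"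
  obtain y b s where path: "pin_path y b s m"
    using pinseq_path[OF ps(3,1)] unfolding m_def by blast
  let ?C = "{l. 2 \<le> l \<and> Suc l < m \<and> s (l - 1) \<noteq> s (Suc l)}"
  have "finite ?C" by (rule finite_subset[of _ "{..<m}"]) auto
  moreover have "card ?C < 4 * k" using changes_alternate[OF path, of k] na not_le by blast
  \<comment> \<open>Fewer than \<open>4 * k\<close> changes cannot meet all \<open>4 * k\<close>
    windows. These start at 2 because a change at \<open>l\<close> involves pin
    \<open>l - 1\<close>, and directions start at index 1.\<close>
  ultimately obtain i where i: "i < 4 * k" "?C \<inter> {2 + i * w..<2 + Suc i * w} = {}"
    using window_avoiding by blast
  have "Suc i * w \<le> 4 * k * w" using i(1) by (intro mult_right_mono) auto
  then have m: "2 + Suc i * w < m" using ps(2) by (simp add: m_def)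
  have "oscillates w"
  proof (rule constant_window_oscillates[OF path, of "2 + i * w"])
    show "s (l - 1) = s (Suc l)" if "2 + i * w \<le> l" "l < 2 + i * w + w" for l
    proof (rule ccontr)
      assume "s (l - 1) \<noteq> s (Suc l)"
      then have "l \<in> ?C" using that m by auto
      moreover have "l \<in> {2 + i * w..<2 + Suc i * w}" using that by simp
      ultimately show False using i(2) by blast
    qed
  qed (use m in auto)
  then show ?thesis ..
qed simp

text \<open>The set \<open>{0, 1}\<close> is sliced by a later entry, which yields an alternation of length 3.\<close>

lemma alternates_3:
  assumes "3 \<le> n" "k \<le> 3"
  shows "alternates k"
proof -
  have "2 \<in> {..<n} - {0, 1}" "{0, 1} \<subseteq> {..<n}" using assms by auto
  then have R: "{0, 1} \<subset> {..<n}" by blast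
  obtain b q where q: "q < n" "q \<notin> {0, 1}" "between b q {0, 1}"
    using sliced[OF R] by auto
  then have b: "b = False" by (auto simp: between_def horizontal)
  then obtain x z where xz: "x \<in> {0, 1}" "z \<in> {0, 1}" "c False x < c False q" "c False q < c False z"
    using q(3) by (auto simp: between_def)
  define u where "u i = (if i = 0 then x else if i = 1 then q else z)" for i :: nat
  have "u i < n \<and> (c True (u i) < int q \<longleftrightarrow> even i)" if "i < k" for i
  proof -
    have "i = 0 \<or> i = 1 \<or> i = 2" using that assms by auto
    then show ?thesis using q xz assms by (auto simp: u_def horizontal)
  qed
  moreover have "c False (u i) < c False (u j)" if "i < j" "j < k" for i j
  proof -
    have "(i = 0 \<and> j = 1) \<or> (i = 0 \<and> j = 2) \<or> (i = 1 \<and> j = 2)" using that assms by auto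
    then show ?thesis using xz by (auto simp: u_def)
  qed
  ultimately show ?thesis unfolding alternates_def
    by (intro exI[of _ True] exI[of _ "int q"] exI[of _ u]) simp
qed

end

section \<open>Permutations as plots\<close>

definition coord :: "nat list \<Rightarrow> bool \<Rightarrow> nat \<Rightarrow> int" where
  "coord p b i = (if b then int i else int (p ! i))"

lemma coord_simps: "coord p True i = int i" "coord p False i = int (p ! i)"
  by (simp_all add: coord_def)

lemma perm_plot: "is_perm p \<Longrightarrow> plot (length p) (coord p)"
  by unfold_locales (auto simp: is_perm_def coord_def inj_on_def nth_eq_iff_index_eq)

text \<open>A set sliced by no outside entry has no gap in position or in value, so it is an
  interval.\<close>

lemma simple_perm_sliced_plot:
  assumes p: "simple_perm p"
  shows "sliced_plot (length p) (coord p)"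
proof -
  have perm: "is_perm p" using p by (simp add: simple_perm_def)
  interpret plot "length p" "coord p" by (rule perm_plot[OF perm])
  show ?thesis
  proof
    fix R assume R: "R \<subset> {..<length p}" "2 \<le> card R"
    show "\<exists>b. \<exists>q\<in>{..<length p} - R. between b q R"
    proof (rule ccontr)
      assume none: "\<not> ?thesis"
      have fin: "finite R" using R finite_subset by blast
      have ne: "R \<noteq> {}" using R(2) by auto
      have eq1: "R = {Min R..<Suc (Max R)}"
      proof
        show "R \<subseteq> {Min R..<Suc (Max R)}" using fin by (auto simp: less_Suc_eq_le)
        show "{Min R..<Suc (Max R)} \<subseteq> R"
        proof (rule ccontr)
          assume "\<not> ?thesis"
          then obtain x where x: "Min R \<le> x" "x \<le> Max R" "x \<notin> R"
            unfolding subset_iff atLeastLessThan_iff less_Suc_eq_le by blast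
          have mm: "Min R \<in> R" "Max R \<in> R" using fin ne by auto
          then have "Min R < x" "x < Max R" "x < length p"
            using x R(1) by (metis order_le_less, metis order_le_less, force)
          then have "between True x R" using mm by (auto simp: between_def coord_simps)
          then show False using none x \<open>x < length p\<close> by blast
        qed
      qed
      let ?V = "(!) p ` R"
      have finV: "finite ?V" "?V \<noteq> {}" using fin ne by auto
      have eq2: "?V = {Min ?V..<Suc (Max ?V)}"
      proof
        show "?V \<subseteq> {Min ?V..<Suc (Max ?V)}" using finV by (auto simp: less_Suc_eq_le)
        show "{Min ?V..<Suc (Max ?V)} \<subseteq> ?V"
        proof (rule ccontr)
          assume "\<not> ?thesis"
          then obtain v where v: "Min ?V \<le> v" "v \<le> Max ?V" "v \<notin> ?V"
            unfolding subset_iff atLeastLessThan_iff less_Suc_eq_le by blast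
          have mm: "Min ?V \<in> ?V" "Max ?V \<in> ?V" using Min_in[OF finV] Max_in[OF finV] by blast+
          then have lt: "Min ?V < v" "v < Max ?V" using v by (metis order_le_less)+
          have "?V \<subseteq> set p" using R(1) by auto
          then have "Min ?V \<in> set p" "Max ?V \<in> set p" using mm by blast+
          then have "v \<in> set p" using lt perm unfolding is_perm_def by auto
          then obtain x where x: "x < length p" "p ! x = v" by (auto simp: in_set_conv_nth)
          obtain r r' where "r \<in> R" "r' \<in> R" "p ! r = Min ?V" "p ! r' = Max ?V"
            using mm by (metis imageE)
          then have "between False x R" using lt x unfolding between_def coord_simps by force
          then show False using none x v by blast
        qed
      qed
      have "Suc (Max R) \<le> length p" using Max_in[OF fin ne] R(1) by auto
      then have "is_interval_of p R" unfolding is_interval_of_def using eq1 eq2 by blast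
      then have "card R \<in> {0, 1, length p}" using p by (auto simp: simple_perm_def)
      moreover have "card R < length p" using psubset_card_mono[OF _ R(1)] by simp
      ultimately show False using R(2) by auto
    qed
  qed (simp add: coord_def)
qed

section \<open>Standardization, subsequences and inverses\<close>

lemma standardize:
  assumes "distinct xs"
  shows "\<exists>q. is_perm q \<and> order_isomorphic xs q"
proof -
  define h where "h x = card {y \<in> set xs. y \<le> x}" for x
  have mono: "h x < h y" if "x < y" "y \<in> set xs" for x y
  proof -
    have "y \<in> {z \<in> set xs. z \<le> y} - {z \<in> set xs. z \<le> x}" using that by auto
    moreover have "{z \<in> set xs. z \<le> x} \<subseteq> {z \<in> set xs. z \<le> y}" using that by auto
    ultimately show ?thesis unfolding h_def by (intro psubset_card_mono) auto
  qed
  have iff: "h x < h y \<longleftrightarrow> x < y" if "x \<in> set xs" "y \<in> set xs" for x y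
    using mono[of x y] mono[of y x] that by (metis less_asym' linorder_neqE_nat)
  have inj: "inj_on h (set xs)"
    using iff by (metis inj_onI less_irrefl linorder_neqE_nat)
  have card: "card (h ` set xs) = length xs" using card_image[OF inj] distinct_card[OF assms] by simp
  have "h x \<in> {1..length xs}" if "x \<in> set xs" for x
  proof -
    have "card {x} \<le> h x" unfolding h_def by (rule card_mono) (use that in auto)
    moreover have "h x \<le> card (set xs)" unfolding h_def by (rule card_mono) auto
    ultimately show ?thesis using distinct_card[OF assms] by simp
  qed
  then have "h ` set xs \<subseteq> {1..length xs}" by blast
  then have "h ` set xs = {1..length xs}" using card by (intro card_subset_eq) auto
  then have "is_perm (map h xs)" using inj assms by (simp add: is_perm_def distinct_map)
  moreover have "order_isomorphic xs (map h xs)" using iff by (simp add: order_isomorphic_def)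
  ultimately show ?thesis by blast
qed

lemma subseq_map_nth:
  assumes "sorted_wrt (<) js" "set js \<subseteq> {..<length p}"
  shows "subseq (map ((!) p) js) p"
proof -
  have "js = filter (\<lambda>i. i \<in> set js) [0..<length p]"
    by (rule sorted_distinct_set_unique)
      (use assms in \<open>auto simp: strict_sorted_iff intro: sorted_wrt_filter\<close>)
  then have "subseq js [0..<length p]" by (metis subseq_filter_left)
  then show ?thesis using subseq_map[of js "[0..<length p]" "(!) p"] by (simp add: map_nth)
qed

lemma perm_inverse_nth:
  assumes "is_perm q" "a < length q"
  obtains i where "i < length q" "q ! i = Suc a" "perm_inverse q ! a = Suc i"
proof -
  have "Suc a \<in> set q" using assms by (auto simp: is_perm_def)
  then obtain i where i: "i < length q" "q ! i = Suc a" by (auto simp: in_set_conv_nth)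
  then have "(THE i. i < length q \<and> q ! i = Suc a) = i"
    using assms(1) by (intro the_equality) (simp, metis is_perm_def nth_eq_iff_index_eq)
  then have "perm_inverse q ! a = Suc i" using assms(2) by (simp add: perm_inverse_def del: upt_Suc)
  with i that show ?thesis by blast
qed

lemma length_perm_inverse [simp]: "length (perm_inverse q) = length q"
  by (simp add: perm_inverse_def del: upt_Suc)

lemma perm_inverse_at:
  assumes "is_perm q" "i < length q"
  shows "perm_inverse q ! (q ! i - 1) = Suc i" "q ! i - 1 < length q" "0 < q ! i"
proof -
  have "q ! i \<in> {1..length q}" using assms nth_mem by (metis is_perm_def)
  then show *: "q ! i - 1 < length q" "0 < q ! i" by auto
  obtain i' where "i' < length q" "q ! i' = Suc (q ! i - 1)" "perm_inverse q ! (q ! i - 1) = Suc i'"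
    using perm_inverse_nth[OF assms(1) *(1)] by blast
  moreover from this have "i' = i"
    using * assms by (auto simp: is_perm_def nth_eq_iff_index_eq)
  ultimately show "perm_inverse q ! (q ! i - 1) = Suc i" by simp
qed

lemma perm_inverse_perm:
  assumes "is_perm q"
  shows "is_perm (perm_inverse q)"
proof -
  have "set (perm_inverse q) = {1..length q}"
  proof
    show "set (perm_inverse q) \<subseteq> {1..length q}"
    proof
      fix v assume "v \<in> set (perm_inverse q)"
      then obtain a where "a < length q" "v = perm_inverse q ! a"
        by (auto simp: in_set_conv_nth)
      then show "v \<in> {1..length q}" using perm_inverse_nth[OF assms] by fastforce
    qed
    show "{1..length q} \<subseteq> set (perm_inverse q)"
    proof
      fix v assume "v \<in> {1..length q}"
      then have "v - 1 < length q" "Suc (v - 1) = v" by auto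
      then show "v \<in> set (perm_inverse q)"
        using perm_inverse_at[OF assms, of "v - 1"] by (metis length_perm_inverse nth_mem)
    qed
  qed
  then show ?thesis by (simp add: is_perm_def card_distinct)
qed

lemma perm_inverse_invol:
  assumes "is_perm q"
  shows "perm_inverse (perm_inverse q) = q"
proof (rule nth_equalityI)
  fix i assume i: "i < length (perm_inverse (perm_inverse q))"
  then have "i < length q" by simp
  note at = perm_inverse_at[OF assms this]
  from perm_inverse_at(1)[OF perm_inverse_perm[OF assms], of "q ! i - 1"] at
  show "perm_inverse (perm_inverse q) ! i = q ! i" by simp
qed simp

text \<open>Index \<open>i\<close> becomes the value \<open>i + 1\<close> of the pattern if the
  dividing line is vertical, and the position \<open>i + 1\<close> if it is horizontal. In the
  second case the inverse has its odd entries to the left.\<close>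

lemma alternates_contains:
  assumes p: "is_perm p" and alt: "plot.alternates (length p) (coord p) k"
  shows "\<exists>q. alternation q \<and> length q = k \<and> contains p q"
proof -
  interpret plot "length p" "coord p" by (rule perm_plot[OF p])
  obtain b t u where u: "\<And>i. i < k \<Longrightarrow> u i < length p \<and> (coord p b (u i) < t \<longleftrightarrow> even i)"
    and mono: "\<And>i j. i < j \<Longrightarrow> j < k \<Longrightarrow> coord p (\<not> b) (u i) < coord p (\<not> b) (u j)"
    using alt unfolding alternates_def by blast
  have mono_iff: "coord p (\<not> b) (u i) < coord p (\<not> b) (u j) \<longleftrightarrow> i < j" if "i < k" "j < k" for i j
    using mono[of i j] mono[of j i] that by (metis less_asym' less_irrefl linorder_neqE_nat)
  show ?thesis
  proof (cases b)
    case True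
    then have b: "b = True" by simp
    note mono = mono_iff[unfolded b coord_simps not_True_eq_False of_nat_less_iff]
    note u = u[unfolded b coord_simps]
    have inj: "inj_on u {..<k}"
      using mono by (metis inj_onI lessThan_iff less_irrefl linorder_neqE_nat)
    define js where "js = sorted_list_of_set (u ` {..<k})"
    define v where "v = the_inv_into {..<k} u"
    define q where "q = map (\<lambda>j. Suc (v j)) js"
    have len: "length js = k" by (simp add: js_def card_image[OF inj])
    have set_js: "set js = u ` {..<k}" by (simp add: js_def)
    have sorted: "sorted_wrt (<) js" by (simp add: js_def)
    have vu: "v (u i) = i" if "i < k" for i using the_inv_into_f_f[OF inj, of i] that by (simp add: v_def)
    have js_nth: "\<exists>i<k. js ! a = u i \<and> q ! a = Suc i" if "a < k" for a
    proof -
      have "js ! a \<in> u ` {..<k}" using nth_mem[of a js] that len set_js by simp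
      then show ?thesis using vu that len by (auto simp: q_def)
    qed
    have "inj_on v (u ` {..<k})" using vu by (auto simp: inj_on_def)
    then have "distinct q" unfolding q_def distinct_map
      using sorted set_js by (auto simp: strict_sorted_iff inj_on_def)
    moreover have "set q = {1..length q}"
    proof -
      have "set q = Suc ` (v ` u ` {..<k})" by (auto simp: q_def set_js)
      also have "v ` u ` {..<k} = {..<k}" using vu by (force simp: image_image)
      also have "Suc ` {..<k} = {1..k}" by (simp add: lessThan_atLeast0 image_Suc_atLeastLessThan atLeastLessThanSuc_atLeastAtMost)
      finally show ?thesis by (simp add: q_def len)
    qed
    ultimately have perm: "is_perm q" by (simp add: is_perm_def)
    have "odds_left_of_evens q" unfolding odds_left_of_evens_def
    proof (intro allI impI)
      fix a a' assume a: "a < length q" "a' < length q" "odd (q ! a) \<and> even (q ! a')"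
      then have a2: "a < k" "a' < k" by (auto simp: q_def len)
      obtain i where i: "i < k" "js ! a = u i" "q ! a = Suc i" using js_nth[OF a2(1)] by blast
      obtain i' where i': "i' < k" "js ! a' = u i'" "q ! a' = Suc i'" using js_nth[OF a2(2)] by blast
      have "js ! a < js ! a'" using a(3) i i' u[of i] u[of i'] by auto
      then show "a < a'"
        using sorted a2 len by (metis less_asym' less_irrefl linorder_neqE_nat sorted_wrt_iff_nth_less)
    qed
    then have "alternation q" unfolding alternation_def
      using perm sym_id by (intro exI[of _ q] exI[of _ id]) simp
    moreover have "order_isomorphic (map ((!) p) js) q"
      unfolding order_isomorphic_def
    proof (intro conjI allI impI)
      fix a a' assume "a < length (map ((!) p) js)" "a' < length (map ((!) p) js)"
      then have a2: "a < k" "a' < k" by (auto simp: len)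
      obtain i where i: "i < k" "js ! a = u i" "q ! a = Suc i" using js_nth[OF a2(1)] by blast
      obtain i' where i': "i' < k" "js ! a' = u i'" "q ! a' = Suc i'" using js_nth[OF a2(2)] by blast
      show "map ((!) p) js ! a < map ((!) p) js ! a' \<longleftrightarrow> q ! a < q ! a'"
        using mono i i' a2 len by simp
    qed (simp add: q_def)
    then have "contains p q" unfolding contains_def
      using subseq_map_nth[OF sorted, of p] u set_js by (intro exI[of _ "map ((!) p) js"]) auto
    ultimately show ?thesis using len by (intro exI[of _ q]) (simp add: q_def)
  next
    case False
    then have b: "b = False" by simp
    note mono = mono_iff[unfolded b not_False_eq_True coord_simps of_nat_less_iff]
    note u = u[unfolded b coord_simps]
    define js where "js = map u [0..<k]"
    define xs where "xs = map ((!) p) js"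
    have sorted: "sorted_wrt (<) js" by (simp add: js_def sorted_wrt_iff_nth_less mono)
    have set_js: "set js \<subseteq> {..<length p}" using u by (auto simp: js_def)
    have "distinct xs" unfolding xs_def
      using sorted set_js p by (auto simp: distinct_map strict_sorted_iff is_perm_def intro!: inj_on_nth)
    then obtain q where q: "is_perm q" "order_isomorphic xs q" using standardize by blast
    have len: "length q = k" using q(2) by (simp add: order_isomorphic_def xs_def js_def)
    have "odds_left_of_evens (perm_inverse q)" unfolding odds_left_of_evens_def
    proof (intro allI impI)
      fix a a' assume a: "a < length (perm_inverse q)" "a' < length (perm_inverse q)"
        "odd (perm_inverse q ! a) \<and> even (perm_inverse q ! a')"
      obtain i where i: "i < length q" "q ! i = Suc a" "perm_inverse q ! a = Suc i"
        using perm_inverse_nth[OF q(1)] a(1) by (metis length_perm_inverse)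
      obtain i' where i': "i' < length q" "q ! i' = Suc a'" "perm_inverse q ! a' = Suc i'"
        using perm_inverse_nth[OF q(1)] a(2) by (metis length_perm_inverse)
      have "p ! u i < p ! u i'" using a(3) i i' u[of i] u[of i'] len by auto
      then have "xs ! i < xs ! i'" using i i' len by (simp add: xs_def js_def)
      then have "q ! i < q ! i'" using q(2) i i' by (auto simp: order_isomorphic_def)
      then show "a < a'" using i i' by simp
    qed
    then have "alternation q" unfolding alternation_def
      using perm_inverse_perm[OF q(1)] perm_inverse_invol[OF q(1)] sym_inverse[OF sym_id]
      by (intro exI[of _ "perm_inverse q"] exI[of _ "perm_inverse \<circ> id"]) simp
    moreover have "contains p q" unfolding contains_def
      using subseq_map_nth[OF sorted set_js] q(2) xs_def by blast
    ultimately show ?thesis using len by blast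
  qed
qed

section \<open>Increasing oscillations of given length and their containment\<close>

lemma order_isomorphic_nth:
  "order_isomorphic xs ys \<Longrightarrow> i < length xs \<Longrightarrow> j < length xs \<Longrightarrow> xs ! i < xs ! j \<longleftrightarrow> ys ! i < ys ! j"
  by (simp add: order_isomorphic_def)

lemma order_isomorphic_rev:
  assumes "order_isomorphic xs ys"
  shows "order_isomorphic (rev xs) (rev ys)"
  unfolding order_isomorphic_def
proof (intro conjI allI impI)
  show len: "length (rev xs) = length (rev ys)" using assms by (simp add: order_isomorphic_def)
  fix i j assume "i < length (rev xs)" "j < length (rev xs)"
  then show "rev xs ! i < rev xs ! j \<longleftrightarrow> rev ys ! i < rev ys ! j"
    using order_isomorphic_nth[OF assms, of "length xs - Suc i" "length xs - Suc j"] len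
    by (simp add: rev_nth)
qed

text \<open>The first \<open>k\<close> points of the inversion path are taken; for odd
  \<open>k\<close> their positions are not an initial segment of the sequence.\<close>

lemma increasing_oscillation_exists:
  assumes k: "4 \<le> k"
  obtains js q where "sorted_wrt (<) js" "set js = osc_rank True ` {..<k}" "length js = k"
    "order_isomorphic (map inc_osc_seq js) q" "increasing_oscillation q"
proof -
  define js where "js = sorted_list_of_set (osc_rank True ` {..<k})"
  have inj: "inj_on (osc_rank True) {..<k}" by (metis inj_onI osc_rank_involution)
  have sorted: "sorted_wrt (<) js" by (simp add: js_def)
  have set_js: "set js = osc_rank True ` {..<k}" by (simp add: js_def)
  have len: "length js = k" by (simp add: js_def card_image[OF inj])
  have "inj inc_osc_seq" unfolding inj_def inc_osc_seq_def by presburger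
  then have "distinct (map inc_osc_seq js)"
    using sorted by (auto simp: distinct_map strict_sorted_iff intro: inj_on_subset)
  then obtain q where q: "is_perm q" "order_isomorphic (map inc_osc_seq js) q"
    using standardize by blast
  have lenq: "length q = k" using q(2) by (simp add: order_isomorphic_def len)
  \<comment> \<open>\<open>osc_rank True\<close> is its own inverse, so \<open>pos a\<close> is the
    path index of entry \<open>a\<close>.\<close>
  define pos where "pos a = osc_rank True (js ! a)" for a
  have pos: "pos a < k" "js ! a = osc_rank True (pos a)" if "a < k" for a
  proof -
    have "js ! a \<in> osc_rank True ` {..<k}" using nth_mem[of a js] that len set_js by simp
    then show "pos a < k" "js ! a = osc_rank True (pos a)"
      by (auto simp: pos_def osc_rank_involution)
  qed
  have cmpT: "osc_rank True (pos a) < osc_rank True (pos a') \<longleftrightarrow> a < a'" if "a < k" "a' < k" for a a'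
  proof -
    have "js ! a < js ! a' \<longleftrightarrow> a < a'"
      using sorted that len by (metis less_asym' less_irrefl linorder_neqE_nat sorted_wrt_iff_nth_less)
    then show ?thesis using pos that by simp
  qed
  have cmpF: "osc_rank False (pos a) < osc_rank False (pos a') \<longleftrightarrow> q ! a < q ! a'"
    if "a < k" "a' < k" for a a'
    using order_isomorphic_nth[OF q(2), of a a'] that pos by (simp add: len inc_osc_seq_rank)
  have pos_inj: "inj_on pos {..<k}"
    by (rule inj_onI) (metis cmpT lessThan_iff less_irrefl linorder_neqE_nat)
  have pos_surj: "pos ` {..<k} = {..<k}"
    using pos(1) pos_inj by (intro endo_inj_surj) auto
  have "simple_perm q"
    unfolding simple_perm_def
  proof (intro conjI allI impI)
    fix I assume "is_interval_of q I"
    then obtain a b v w where I: "I = {a..<b}" "b \<le> k" "(!) q ` I = {v..<w}"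
      unfolding is_interval_of_def lenq by blast
    show "card I \<in> {0, 1, length q}"
    proof (cases "card I \<le> 1")
      case False
      then have ab: "Suc a < b" using I(1) by simp
      have sub: "I \<subseteq> {..<k}" using I by auto
      \<comment> \<open>An interval is convex in position and in value; transported to path indices,
        this is the hypothesis of \<open>osc_rank_convex\<close>.\<close>
      have conv: "pos z \<in> pos ` I"
        if z: "z < k" "x \<in> I" "y \<in> I" "osc_rank c (pos x) < osc_rank c (pos z)"
          "osc_rank c (pos z) < osc_rank c (pos y)" for c x y z
      proof -
        have xy: "x < k" "y < k" using that sub by auto
        have "z \<in> I"
        proof (cases c)
          case True
          then show ?thesis using z xy cmpT I(1) by auto
        next
          case False
          then have "q ! x < q ! z" "q ! z < q ! y" using z xy cmpF by auto
          moreover have "q ! x \<in> {v..<w}" "q ! y \<in> {v..<w}" using I(3) z by blast+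
          ultimately have "q ! z \<in> (!) q ` I" using I(3) by auto
          then obtain x' where "x' \<in> I" "q ! x' = q ! z" by auto
          then show ?thesis
            using q(1) sub z(1) lenq by (auto simp: is_perm_def nth_eq_iff_index_eq subset_iff)
        qed
        then show ?thesis by blast
      qed
      have conv': "l \<in> pos ` I"
        if l: "i \<in> pos ` I" "j \<in> pos ` I" "l < k" "osc_rank c i < osc_rank c l"
          "osc_rank c l < osc_rank c j" for c i j l
      proof -
        have "l \<in> pos ` {..<k}" using l(3) pos_surj by simp
        then obtain z where z: "z < k" "l = pos z" by blast
        obtain x y where xy: "x \<in> I" "y \<in> I" "i = pos x" "j = pos y" using l(1,2) by blast
        show ?thesis using conv[OF z(1) xy(1,2), of c] l z xy by simp
      qed
      have mem: "pos a \<in> pos ` I" "pos (Suc a) \<in> pos ` I" using ab I by auto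
      have ne: "pos a \<noteq> pos (Suc a)" using inj_onD[OF pos_inj, of a "Suc a"] ab I by auto
      have subJ: "pos ` I \<subseteq> {..<k}" using pos_surj sub by blast
      have "pos ` I = {..<k}"
      proof (cases "pos a < pos (Suc a)")
        case True
        show ?thesis by (rule osc_rank_convex[OF k subJ mem True conv'])
      next
        case False
        then have "pos (Suc a) < pos a" using ne by simp
        from osc_rank_convex[OF k subJ mem(2,1) this conv'] show ?thesis .
      qed
      then have "card I = k"
        using card_image[OF inj_on_subset[OF pos_inj sub]] by simp
      then show ?thesis using lenq by simp
    qed auto
  qed (rule q)
  then have "increasing_oscillation q"
    unfolding increasing_oscillation_def seq_contains_def using sorted q(2) by blast
  then show thesis using that sorted set_js len q(2) by blast
qed

lemma oscillates_contains:
  assumes p: "is_perm p" and k: "4 \<le> k" and osc: "plot.oscillates (length p) (coord p) (2 * k)"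
  shows "\<exists>q. oscillation q \<and> length q = k \<and> contains p q"
proof -
  interpret plot "length p" "coord p" by (rule perm_plot[OF p])
  \<comment> \<open>Evenness is needed only to normalize the signs; afterwards the first
    \<open>k\<close> points suffice.\<close>
  have "even (2 * k)" by simp
  from oscillates_rank[OF this osc, unfolded coord_simps of_nat_less_iff]
  obtain w \<sigma> where W: "\<forall>i<2 * k. w i < length p" and s: "\<sigma> \<in> {1, -1}"
    and C: "\<forall>i<2 * k. \<forall>j<2 * k.
      (\<sigma> * int (w i) < \<sigma> * int (w j) \<longleftrightarrow> osc_rank True i < osc_rank True j) \<and>
      (p ! w i < p ! w j \<longleftrightarrow> osc_rank False i < osc_rank False j)"
    by (elim exE conjE)
  have w: "w i < length p" if "i < k" for i using W that by simp
  have cmp: "(\<sigma> * int (w i) < \<sigma> * int (w j) \<longleftrightarrow> osc_rank True i < osc_rank True j) \<and>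
      (p ! w i < p ! w j \<longleftrightarrow> osc_rank False i < osc_rank False j)" if "i < k" "j < k" for i j
    using C that by simp
  obtain js q where js: "sorted_wrt (<) js" "set js = osc_rank True ` {..<k}" "length js = k"
    and q: "order_isomorphic (map inc_osc_seq js) q" "increasing_oscillation q"
    using increasing_oscillation_exists[OF k] .
  define h where "h j = w (osc_rank True j)" for j
  define ys where "ys = map h js"
  have js_nth: "\<exists>i<k. js ! a = osc_rank True i \<and> ys ! a = w i" if "a < k" for a
  proof -
    have "js ! a \<in> osc_rank True ` {..<k}" using nth_mem[of a js] that js by simp
    then show ?thesis using that js(3) by (auto simp: ys_def h_def osc_rank_involution)
  qed
  have leny: "length ys = k" "length q = k" using js(3) q(1) by (simp_all add: ys_def order_isomorphic_def)
  have ys_lt: "set ys \<subseteq> {..<length p}" using w js(2) by (auto simp: ys_def h_def osc_rank_involution)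
  have iso: "order_isomorphic (map ((!) p) ys) q"
    unfolding order_isomorphic_def
  proof (intro conjI allI impI)
    fix a a' assume "a < length (map ((!) p) ys)" "a' < length (map ((!) p) ys)"
    then have a: "a < k" "a' < k" by (auto simp: leny)
    obtain i where i: "i < k" "js ! a = osc_rank True i" "ys ! a = w i" using js_nth[OF a(1)] by blast
    obtain i' where i': "i' < k" "js ! a' = osc_rank True i'" "ys ! a' = w i'" using js_nth[OF a(2)] by blast
    have "q ! a < q ! a' \<longleftrightarrow> inc_osc_seq (js ! a) < inc_osc_seq (js ! a')"
      using order_isomorphic_nth[OF q(1), of a a'] a js(3) by simp
    then show "map ((!) p) ys ! a < map ((!) p) ys ! a' \<longleftrightarrow> q ! a < q ! a'"
      using i i' cmp a leny by (simp add: inc_osc_seq_rank)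
  qed (simp add: leny)
  have mono: "\<sigma> * int (ys ! a) < \<sigma> * int (ys ! a')" if a: "a < a'" "a' < k" for a a'
  proof -
    have "js ! a < js ! a'" using js a by (simp add: sorted_wrt_iff_nth_less)
    moreover obtain i where "i < k" "js ! a = osc_rank True i" "ys ! a = w i"
      using js_nth[of a] a by auto
    moreover obtain i' where "i' < k" "js ! a' = osc_rank True i'" "ys ! a' = w i'"
      using js_nth[of a'] a by auto
    ultimately show ?thesis using cmp by simp
  qed
  show ?thesis
  proof (cases "\<sigma> = 1")
    case True
    then have "sorted_wrt (<) ys" using mono leny by (simp add: sorted_wrt_iff_nth_less)
    then have "contains p q"
      using subseq_map_nth[OF _ ys_lt] iso unfolding contains_def by blast
    then show ?thesis using q leny by (auto simp: oscillation_def)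
  next
    \<comment> \<open>With \<open>\<sigma> = -1\<close> the points run from right to left, so the
      permutation contains the reversed pattern, a decreasing oscillation.\<close>
    case False
    then have "sorted_wrt (>) ys" using mono leny s by (simp add: sorted_wrt_iff_nth_less)
    then have "sorted_wrt (<) (rev ys)" by (simp add: sorted_wrt_rev)
    then have "subseq (map ((!) p) (rev ys)) p" using subseq_map_nth[of "rev ys" p] ys_lt by simp
    then have "contains p (rev q)"
      using order_isomorphic_rev[OF iso] unfolding contains_def by (metis rev_map)
    then show ?thesis
      using q leny by (intro exI[of _ "rev q"]) (auto simp: oscillation_def decreasing_oscillation_def)
  qed
qed

theorem theorem6p1:
  fixes k :: nat
  assumes "k > 0"
  shows "\<exists>N. \<forall>p. simple_perm p \<and> length p \<ge> N \<longrightarrow>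
           (\<exists>q. alternation q \<and> length q = k \<and> contains p q) \<or>
           (\<exists>q. oscillation q \<and> length q = k \<and> contains p q)"
proof (intro exI allI impI)
  fix p
  assume p: "simple_perm p \<and>
    2 * (2 * k * (\<Sum>i<4 * k * (2 * k) + 3. (4 * k) ^ i)) + 5 \<le> length p"
  then have perm: "is_perm p" by (simp add: simple_perm_def)
  interpret sliced_plot "length p" "coord p" using p simple_perm_sliced_plot by blast
  \<comment> \<open>The summand 5 in the bound also guarantees the three entries that
    \<open>alternates_3\<close> requires.\<close>
  have "alternates k \<or> (4 \<le> k \<and> oscillates (2 * k))"
  proof (cases "4 \<le> k")
    case True
    then show ?thesis using alternates_or_oscillates[of k "2 * k"] p by blast
  next
    case False
    then show ?thesis using alternates_3[of k] p by linarith
  qed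
  then show "(\<exists>q. alternation q \<and> length q = k \<and> contains p q) \<or>
    (\<exists>q. oscillation q \<and> length q = k \<and> contains p q)"
    using alternates_contains[OF perm] oscillates_contains[OF perm] by blast
qed

end
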